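(* Let $C,D$ be two basic convex semi-algebraic sets in $\mathbb{R}^n$ with $C\cap D\ne\emptyset$, given by $$C:=\{x\in\mathbb{R}^n: g_i(x)\le0,\ i=1,\dots,m_1\},\qquad D:=\{x\in\mathbb{R}^n: h_j(x)\le0,\ j=1,\dots,m_2\},$$ where $g_i,h_j$ ($i=1,\dots,m_1$, $j=1,\dots,m_2$) are convex polynomials on $\mathbb{R}^n$ with degree at most $d$ (with $d\ge1$ an integer). Let $\eta>0$, let $\lambda_t\in(0,2]$ for $t\in\mathbb{N}$ with $\lambda:=\inf_{t\in\mathbb{N}}\lambda_t>0$, and let $\{(y^t,z^t,x^t)\}$ be generated, from an arbitrary initial point $x^0\in\mathbb{R}^n$, by the damped Douglas--Rachford algorithm $$y^{t+1}:=P_C^\eta(x^t),\qquad z^{t+1}:=P_D^\eta(2y^{t+1}-x^t),\qquad x^{t+1}:=x^t+\lambda_t(z^{t+1}-y^{t+1}),\qquad t\in\mathbb{N}.$$ Then $x^t\to\bar x$ for some $\bar x\in C\cap D$. Moreover, there exist $M>0$ and $r\in(0,1)$ such that, for all $t\ge1$, $$\|x^t-\bar x\|\le\begin{cases}M\,t^{-\frac{\gamma}{2(1-\gamma)}}&\text{if } d>1,\\ M\,r^t&\text{if } d=1,\end{cases}$$ where $$\gamma=\left(\min\left\{\frac{(2d-1)^n+1}{2},\ B(n-1)\,d^n\right\}\right)^{-1}$$ and $B(n-1)=\binom{n-1}{\lfloor (n-1)/2\rfloor}$ is the central binomial coefficient with respect to $n-1$.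
   Context: For a non-empty closed convex set $A$ and $\eta>0$, $P_A$ denotes the nearest point projection onto $A$, and $P_A^\eta:=\frac{1}{2\eta+1}I+\frac{2\eta}{2\eta+1}P_A$, where $I$ is the identity. $\mathbb{N}=\{0,1,2,\dots\}$. A basic semi-algebraic convex set in $\mathbb{R}^n$ is a set of the form $\{x: g_j(x)\le0,\ j=1,\dots,k\}$ for finitely many convex polynomials $g_j$. *)

theory Defs
  imports "HOL-Analysis.Analysis" "HOL-Library.Poly_Mapping"
begin

text \<open>
  A real polynomial in variables indexed by \<open>'n\<close> is a finitely supported map from exponent
  vectors (themselves finitely supported maps from \<open>'n\<close> to \<open>nat\<close>) to real coefficients.
\<close>
type_synonym 'n rpoly = "('n \<Rightarrow>\<^sub>0 nat) \<Rightarrow>\<^sub>0 real"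

definition poly_fun :: "('n::finite) rpoly \<Rightarrow> real ^ 'n \<Rightarrow> real" where
  "poly_fun p x =
     (\<Sum>m\<in>Poly_Mapping.keys p.
        Poly_Mapping.lookup p m * (\<Prod>k\<in>UNIV. (x $ k) ^ Poly_Mapping.lookup m k))"

text \<open>The zero polynomial gets total degree 0.\<close>
definition total_deg :: "('n::finite) rpoly \<Rightarrow> nat" where
  "total_deg p =
     Max (insert 0 ((\<lambda>m. \<Sum>k\<in>UNIV. Poly_Mapping.lookup m k) ` Poly_Mapping.keys p))"

definition convex_poly :: "('n::finite) rpoly \<Rightarrow> bool" where
  "convex_poly p \<longleftrightarrow> convex_on UNIV (poly_fun p)"

text \<open>
  The set defined by \<open>g\<^sub>1, \<dots>, g\<^sub>m\<close>; values of \<open>g\<close> outside \<open>{1..m}\<close> are irrelevant.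
  It is a basic convex semi-algebraic set when all these polynomials are convex.
\<close>
definition sublevel_set :: "nat \<Rightarrow> (nat \<Rightarrow> ('n::finite) rpoly) \<Rightarrow> (real ^ 'n) set" where
  "sublevel_set m g = {x. \<forall>i\<in>{1..m}. poly_fun (g i) x \<le> 0}"

definition damped_proj :: "real \<Rightarrow> (real ^ 'n) set \<Rightarrow> real ^ 'n \<Rightarrow> real ^ ('n::finite)" where
  "damped_proj \<eta> A x =
     (1 / (2 * \<eta> + 1)) *\<^sub>R x + (2 * \<eta> / (2 * \<eta> + 1)) *\<^sub>R closest_point A x"

definition central_binom :: "nat \<Rightarrow> nat" where
  "central_binom k = k choose (k div 2)"

definition rate_gamma :: "nat \<Rightarrow> nat \<Rightarrow> real" where
  "rate_gamma n d =
     inverse (min (((2 * real d - 1) ^ n + 1) / 2) (real (central_binom (n - 1)) * real d ^ n))"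

end

theory Submission
  imports Defs "HOL-Computational_Algebra.Polynomial"
begin

text \<open>
  The deep effective Lojasiewicz inequalities behind the constant \<open>\<gamma>\<close> can be avoided, since both
  terms of its minimum are at least \<open>d\<^sup>n\<close>: it suffices to bound the distance to \<open>C \<inter> D\<close> locally by
  a multiple of the \<open>1 / d\<^sup>n\<close>-th power of the larger of the distances to \<open>C\<close> and \<open>D\<close>.
  This is done by facial reduction. If the system \<open>f\<^sub>i \<le> 0\<close> has no Slater point, some nontrivial
  nonnegative combination \<open>F\<close> of the \<open>f\<^sub>i\<close> is nonnegative. Its zero set contains the solution
  set, is affine (a polynomial vanishing on a segment vanishes on the line), and on bounded sets
  \<open>F\<close> dominates the \<open>d\<close>-th power of the distance to it. So each drop of the dimension
  costs one factor \<open>d\<close> in the exponent. If \<open>F\<close> vanishes identically, the \<open>f\<^sub>i\<close> of positive weight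
  are affine, and one of them is used in place of \<open>F\<close> or dropped.

  The reflections \<open>2 P\<^sup>\<eta> - I\<close> are relaxed projections with relaxation parameter
  \<open>4 \<eta> / (2 \<eta> + 1) < 2\<close>, so even for \<open>\<lambda>\<^sub>t = 2\<close> one step decreases the squared distance to every
  point of \<open>C \<inter> D\<close> by a multiple of the squared larger distance to \<open>C\<close> and \<open>D\<close>. The squared distance
  \<open>b\<^sub>t\<close> to \<open>C \<inter> D\<close> then satisfies
  \<open>b\<^bsub>t+1\<^esub> \<le> b\<^sub>t - \<kappa> b\<^sub>t\<^sup>N\<close> with \<open>N = d\<^sup>n\<close>.
\<close>

section \<open>Polynomial restrictions to lines\<close>

text \<open>Coordinate-free substitute for being a polynomial of degree at most \<open>d\<close>.
  The error bounds look at a function only along lines, so they need neither monomials nor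
  coordinates.\<close>

definition line_poly :: "nat \<Rightarrow> ('a::real_vector \<Rightarrow> real) \<Rightarrow> bool" where
  "line_poly d f \<longleftrightarrow> (\<forall>a v. \<exists>q. degree q \<le> d \<and> (\<forall>s. f (a + s *\<^sub>R v) = poly q s))"

lemma line_poly_sum:
  assumes "finite I" and "\<And>i. i \<in> I \<Longrightarrow> line_poly d (f i)"
  shows "line_poly d (\<lambda>x. \<Sum>i\<in>I. l i * f i x)"
  unfolding line_poly_def
proof (intro allI)
  fix a v
  have "\<exists>q. \<forall>i\<in>I. degree (q i) \<le> d \<and> (\<forall>s. f i (a + s *\<^sub>R v) = poly (q i) s)"
    using assms(2) unfolding line_poly_def by (intro bchoice) blast
  then obtain q where q: "\<And>i. i \<in> I \<Longrightarrow> degree (q i) \<le> d"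
      "\<And>i s. i \<in> I \<Longrightarrow> f i (a + s *\<^sub>R v) = poly (q i) s"
    by blast
  have "degree (\<Sum>i\<in>I. smult (l i) (q i)) \<le> d"
    using assms(1) q(1) by (intro degree_sum_le) (auto intro: order_trans[OF degree_smult_le])
  moreover have "(\<Sum>i\<in>I. l i * f i (a + s *\<^sub>R v)) = poly (\<Sum>i\<in>I. smult (l i) (q i)) s" for s
    using q(2) by (simp add: poly_sum)
  ultimately show "\<exists>q. degree q \<le> d \<and> (\<forall>s. (\<Sum>i\<in>I. l i * f i (a + s *\<^sub>R v)) = poly q s)"
    by blast
qed

lemma line_poly_poly_fun:
  fixes p :: "('n::finite) rpoly"
  assumes "total_deg p \<le> d"
  shows "line_poly d (poly_fun p)"
  unfolding line_poly_def
proof (intro allI)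
  fix a v :: "real ^ 'n"
  define r where "r m = (\<Prod>k\<in>UNIV. [:a $ k, v $ k:] ^ Poly_Mapping.lookup m k)" for m :: "'n \<Rightarrow>\<^sub>0 nat"
  define q where "q = (\<Sum>m\<in>Poly_Mapping.keys p. smult (Poly_Mapping.lookup p m) (r m))"
  have "degree (r m) \<le> d" if "m \<in> Poly_Mapping.keys p" for m
  proof -
    have "degree (r m) \<le> (\<Sum>k\<in>UNIV. degree ([:a $ k, v $ k:] ^ Poly_Mapping.lookup m k))"
      unfolding r_def using degree_prod_sum_le[OF finite_class.finite_UNIV] by (simp add: o_def)
    also have "\<dots> \<le> (\<Sum>k\<in>UNIV. Poly_Mapping.lookup m k)"
    proof (rule sum_mono)
      fix k
      have "degree ([:a $ k, v $ k:] ^ Poly_Mapping.lookup m k)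
          \<le> degree [:a $ k, v $ k:] * Poly_Mapping.lookup m k"
        by (rule degree_power_le)
      also have "\<dots> \<le> 1 * Poly_Mapping.lookup m k"
        by (intro mult_right_mono) auto
      finally show "degree ([:a $ k, v $ k:] ^ Poly_Mapping.lookup m k) \<le> Poly_Mapping.lookup m k"
        by simp
    qed
    also have "\<dots> \<le> total_deg p"
      unfolding total_deg_def using that by (intro Max_ge) auto
    finally show ?thesis using assms by simp
  qed
  then have "degree q \<le> d"
    unfolding q_def by (intro degree_sum_le) (auto intro: order_trans[OF degree_smult_le])
  moreover have "poly_fun p (a + s *\<^sub>R v) = poly q s" for s
    by (simp add: poly_fun_def q_def r_def poly_sum poly_prod poly_power mult.commute)
  ultimately show "\<exists>q. degree q \<le> d \<and> (\<forall>s. poly_fun p (a + s *\<^sub>R v) = poly q s)"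
    by blast
qed

text \<open>The values at the \<open>d + 1\<close> nodes 0, ..., d determine a polynomial of degree
  at most \<open>d\<close>, hence control its growth. In the induction, synthetic division at the
  last node \<open>a\<close> gives q(t) = (t - a) r(t) + q(a); since |k - a| \<ge> 1 at the other
  nodes, \<open>r\<close> is bounded by \<open>2 * B\<close> there.\<close>

lemma poly_growth:
  "\<exists>K>0. \<forall>(q::real poly) B T. degree q \<le> d \<longrightarrow> (\<forall>k\<le>d. \<bar>poly q (real k)\<bar> \<le> B) \<longrightarrow> 1 \<le> T
     \<longrightarrow> \<bar>poly q T\<bar> \<le> K * B * T ^ d"
proof (induction d)
  case 0
  show ?case
  proof (intro exI[of _ 1] conjI allI impI)
    fix q :: "real poly" and B T :: real
    assume "degree q \<le> 0" and "\<forall>k\<le>0. \<bar>poly q (real k)\<bar> \<le> B"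
    moreover from \<open>degree q \<le> 0\<close> obtain b where "q = [:b:]"
      by (auto elim: degree_eq_zeroE)
    ultimately show "\<bar>poly q T\<bar> \<le> 1 * B * T ^ 0"
      by simp
  qed simp
next
  case (Suc d)
  then obtain K where "K > 0" and K: "\<And>(q::real poly) B T. degree q \<le> d \<Longrightarrow>
      (\<And>k. k \<le> d \<Longrightarrow> \<bar>poly q (real k)\<bar> \<le> B) \<Longrightarrow> 1 \<le> T \<Longrightarrow> \<bar>poly q T\<bar> \<le> K * B * T ^ d"
    by blast
  define a where "a = real (Suc d)"
  show ?case
  \<comment> \<open>The summand 1 absorbs |q(a)| \<le> B, the factor \<open>1 + a\<close> comes from
    |T - a| \<le> (1 + a) T for T \<ge> 1, and \<open>K * 2\<close> from the bound on
    \<open>r\<close>.\<close>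
  proof (intro exI[of _ "1 + (1 + a) * (K * 2)"] conjI allI impI)
    show "0 < 1 + (1 + a) * (K * 2)"
      using \<open>K > 0\<close> by (intro add_pos_nonneg) (auto simp: a_def)
    fix q :: "real poly" and B T :: real
    assume deg: "degree q \<le> Suc d" and B: "\<forall>k\<le>Suc d. \<bar>poly q (real k)\<bar> \<le> B" and T: "1 \<le> T"
    define r where "r = synthetic_div q a"
    have q: "poly q t = (t - a) * poly r t + poly q a" for t
    proof -
      have "poly q t = poly ([:- a, 1:] * r + [:poly q a:]) t"
        unfolding r_def by (simp only: synthetic_div_correct')
      then show ?thesis by (simp add: algebra_simps)
    qed
    have Ba: "\<bar>poly q a\<bar> \<le> B"
      using B unfolding a_def by blast
    then have "B \<ge> 0" by linarith
    have "\<bar>poly r T\<bar> \<le> K * (2 * B) * T ^ d"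
    proof (rule K)
      show "degree r \<le> d"
        using deg by (simp add: r_def degree_synthetic_div)
      show "\<bar>poly r (real k)\<bar> \<le> 2 * B" if "k \<le> d" for k
      proof -
        have "1 \<le> \<bar>real k - a\<bar>"
          using that by (simp add: a_def)
        then have "\<bar>poly r (real k)\<bar> \<le> \<bar>real k - a\<bar> * \<bar>poly r (real k)\<bar>"
          using mult_right_mono[of 1 "\<bar>real k - a\<bar>" "\<bar>poly r (real k)\<bar>"] by simp
        also have "\<dots> = \<bar>poly q (real k) - poly q a\<bar>"
          using q[of "real k"] by (simp add: abs_mult)
        also have "\<dots> \<le> 2 * B"
        proof -
          have "\<bar>poly q (real k)\<bar> \<le> B" using B that by simp
          then show ?thesis using Ba by linarith
        qed
        finally show ?thesis .
      qed
    qed (rule T)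
    moreover have "\<bar>T - a\<bar> \<le> (1 + a) * T"
    proof -
      have "0 \<le> a * (T - 1)" using T by (simp add: a_def)
      moreover have "\<bar>T - a\<bar> \<le> T + a" using T by (simp add: a_def)
      ultimately show ?thesis by (simp add: algebra_simps)
    qed
    ultimately have "\<bar>T - a\<bar> * \<bar>poly r T\<bar> \<le> ((1 + a) * T) * (K * (2 * B) * T ^ d)"
      using T by (intro mult_mono) (auto simp: a_def)
    moreover have "B * 1 \<le> B * T ^ Suc d"
      using \<open>B \<ge> 0\<close> T by (intro mult_left_mono one_le_power)
    moreover have "\<bar>poly q T\<bar> \<le> \<bar>T - a\<bar> * \<bar>poly r T\<bar> + B"
      using Ba q[of T] abs_triangle_ineq[of "(T - a) * poly r T" "poly q a"] by (simp add: abs_mult)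
    ultimately show "\<bar>poly q T\<bar> \<le> (1 + (1 + a) * (K * 2)) * B * T ^ Suc d"
      by (simp add: algebra_simps)
  qed
qed

text \<open>Rescaling \<open>[0, s]\<close> to \<open>[0, d]\<close>, this is the growth bound at \<open>d / s\<close>.\<close>
lemma increasing_poly_lower_bound:
  assumes "d \<ge> 1"
  shows "\<exists>K>0. \<forall>(q::real poly) s. degree q \<le> d \<longrightarrow>
     (\<forall>u v. 0 \<le> u \<longrightarrow> u \<le> v \<longrightarrow> v \<le> 1 \<longrightarrow> 0 \<le> poly q u \<and> poly q u \<le> poly q v) \<longrightarrow>
     0 < s \<longrightarrow> s \<le> 1 \<longrightarrow> poly q 1 * s ^ d \<le> K * poly q s"
proof -
  obtain K where "K > 0" and K: "\<And>(q::real poly) B T. degree q \<le> d \<Longrightarrow>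
      (\<And>k. k \<le> d \<Longrightarrow> \<bar>poly q (real k)\<bar> \<le> B) \<Longrightarrow> 1 \<le> T \<Longrightarrow> \<bar>poly q T\<bar> \<le> K * B * T ^ d"
    using poly_growth[of d] by blast
  show ?thesis
  proof (intro exI[of _ "K * real d ^ d"] conjI allI impI)
    show "0 < K * real d ^ d"
      using \<open>K > 0\<close> assms by simp
    fix q :: "real poly" and s :: real
    assume deg: "degree q \<le> d" and s: "0 < s" "s \<le> 1"
      and mono: "\<forall>u v. 0 \<le> u \<longrightarrow> u \<le> v \<longrightarrow> v \<le> 1 \<longrightarrow> 0 \<le> poly q u \<and> poly q u \<le> poly q v"
    define r where "r = pcompose q [:0, s / d:]"
    have r: "poly r t = poly q (t * s / d)" for t
      by (simp add: r_def poly_pcompose)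
    have "\<bar>poly r (d / s)\<bar> \<le> K * poly q s * (d / s) ^ d"
    proof (rule K)
      show "degree r \<le> d"
        using degree_pcompose_le[of q "[:0, s / d:]"] deg by (auto simp: r_def split: if_splits)
      show "\<bar>poly r (real k)\<bar> \<le> poly q s" if "k \<le> d" for k
      proof -
        have "real k * s / d \<le> s"
          using that s assms by (simp add: field_simps)
        moreover have "0 \<le> real k * s / d"
          using s by simp
        ultimately show ?thesis
          using mono s unfolding r by (auto simp: abs_of_nonneg)
      qed
      show "1 \<le> real d / s"
        using s assms by (simp add: field_simps)
    qed
    moreover have "poly r (d / s) = poly q 1"
      using s assms by (simp add: r)
    ultimately have "poly q 1 \<le> K * poly q s * (d / s) ^ d"
      by linarith
    then have "poly q 1 * s ^ d \<le> K * poly q s * (d / s) ^ d * s ^ d"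
      using s by (intro mult_right_mono) auto
    also have "\<dots> = K * real d ^ d * poly q s"
      using s by (simp add: power_divide)
    finally show "poly q 1 * s ^ d \<le> K * real d ^ d * poly q s" .
  qed
qed

section \<open>Convex functions and a theorem of the alternative\<close>

text \<open>On the line through two zeros in \<open>L\<close>, convexity makes the restriction of
  \<open>f\<close> vanish on a whole segment. This is a polynomial with infinitely many roots, so it
  vanishes on the line.\<close>

lemma affine_zero_set:
  assumes "affine L" "convex {x \<in> L. f x = 0}" "line_poly d f"
  shows "affine {x \<in> L. f x = 0}"
  unfolding affine_alt
proof (intro ballI allI)
  fix x y and u :: real
  assume x: "x \<in> {x \<in> L. f x = 0}" and y: "y \<in> {x \<in> L. f x = 0}"
  obtain q where q: "\<And>s. f (x + s *\<^sub>R (y - x)) = poly q s"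
    using assms(3) unfolding line_poly_def by blast
  have pt: "x + s *\<^sub>R (y - x) = (1 - s) *\<^sub>R x + s *\<^sub>R y" for s
    by (simp add: algebra_simps)
  have "{0..1} \<subseteq> {s. poly q s = 0}"
  proof
    fix s :: real
    assume "s \<in> {0..1}"
    then have "(1 - s) *\<^sub>R x + s *\<^sub>R y \<in> {x \<in> L. f x = 0}"
      using assms(2) x y by (intro convexD_alt) auto
    then show "s \<in> {s. poly q s = 0}"
      using q[of s] by (simp add: pt)
  qed
  moreover have "infinite {0..1::real}"
    by simp
  ultimately have "q = 0"
    using poly_roots_finite finite_subset by blast
  then have "f ((1 - u) *\<^sub>R x + u *\<^sub>R y) = 0"
    using q[of u] by (simp add: pt)
  moreover have "(1 - u) *\<^sub>R x + u *\<^sub>R y \<in> L"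
    using assms(1) x y by (auto simp: affine_alt)
  ultimately show "(1 - u) *\<^sub>R x + u *\<^sub>R y \<in> {x \<in> L. f x = 0}"
    by simp
qed

text \<open>\<open>f\<close> is bounded by some B on the ball of radius \<open>R + 1\<close>.
  Prolonging the segment from \<open>x\<close> to \<open>y\<close> by length 1 beyond
  \<open>y\<close> reaches a point \<open>z\<close> of that ball, and convexity between
  \<open>x\<close> and \<open>z\<close> bounds the slope by the oscillation
  \<open>2 * B\<close>.\<close>

lemma convex_on_UNIV_lipschitz:
  fixes f :: "'a::euclidean_space \<Rightarrow> real"
  assumes "convex_on UNIV f"
  shows "\<exists>c>0. \<forall>x y. norm x \<le> R \<longrightarrow> norm y \<le> R \<longrightarrow> f y \<le> f x + c * dist x y"
proof -
  have "continuous_on (cball 0 (R + 1)) f"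
    using convex_on_continuous[OF open_UNIV assms] continuous_on_subset by blast
  then have "bounded (f ` cball 0 (R + 1))"
    by (intro compact_imp_bounded compact_continuous_image) auto
  then obtain B where "B > 0" and "\<And>w. w \<in> f ` cball 0 (R + 1) \<Longrightarrow> norm w \<le> B"
    unfolding bounded_pos by blast
  then have B: "\<bar>f w\<bar> \<le> B" if "norm w \<le> R + 1" for w
    using that by simp
  show ?thesis
  proof (intro exI[of _ "2 * B"] conjI allI impI)
    fix x y :: 'a
    assume nx: "norm x \<le> R" and ny: "norm y \<le> R"
    show "f y \<le> f x + 2 * B * dist x y"
    proof (cases "x = y")
      case False
      define \<rho> where "\<rho> = norm (y - x)"
      have "\<rho> > 0" using False by (simp add: \<rho>_def)
      define z where "z = y + (1 / \<rho>) *\<^sub>R (y - x)"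
      have "norm z \<le> norm y + norm ((1 / \<rho>) *\<^sub>R (y - x))"
        unfolding z_def by (rule norm_triangle_ineq)
      also have "norm ((1 / \<rho>) *\<^sub>R (y - x)) = 1"
        using \<open>\<rho> > 0\<close> by (simp add: \<rho>_def)
      finally have nz: "norm z \<le> R + 1" using ny by simp
      define t where "t = \<rho> / (1 + \<rho>)"
      have t: "0 \<le> t" "t \<le> 1" "t \<le> \<rho>"
        using \<open>\<rho> > 0\<close> by (auto simp: t_def field_simps)
      have "(1 + \<rho>) *\<^sub>R ((1 - t) *\<^sub>R x + t *\<^sub>R z) = (1 + \<rho>) *\<^sub>R y"
      proof -
        have "(1 + \<rho>) * (1 - t) = 1" "(1 + \<rho>) * t = \<rho>"
          using \<open>\<rho> > 0\<close> by (auto simp: t_def field_simps)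
        then have "(1 + \<rho>) *\<^sub>R ((1 - t) *\<^sub>R x + t *\<^sub>R z) = x + \<rho> *\<^sub>R z"
          by (simp add: scaleR_add_right)
        also have "\<dots> = (1 + \<rho>) *\<^sub>R y"
          using \<open>\<rho> > 0\<close> by (simp add: z_def algebra_simps)
        finally show ?thesis .
      qed
      then have y: "(1 - t) *\<^sub>R x + t *\<^sub>R z = y"
        using \<open>\<rho> > 0\<close> by simp
      have "f y \<le> (1 - t) * f x + t * f z"
        using convex_onD[OF assms t(1,2), of x z] y by simp
      also have "\<dots> = f x + t * (f z - f x)"
        by (simp add: algebra_simps)
      also have "t * (f z - f x) \<le> \<rho> * (2 * B)"
      proof -
        have "f z - f x \<le> 2 * B"
          using B[OF nz] B[of x] nx by linarith
        then have "t * (f z - f x) \<le> t * (2 * B)"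
          using t by (intro mult_left_mono)
        also have "\<dots> \<le> \<rho> * (2 * B)"
          using t \<open>B > 0\<close> by (intro mult_right_mono) auto
        finally show ?thesis .
      qed
      finally show ?thesis
        by (simp add: \<rho>_def dist_norm norm_minus_commute mult.commute)
    qed simp
  qed (use \<open>B > 0\<close> in simp)
qed

lemma convex_on_weighted_sum:
  assumes "finite I" "convex X" "\<And>i. i \<in> I \<Longrightarrow> convex_on X (f i)" "\<And>i. i \<in> I \<Longrightarrow> 0 \<le> l i"
  shows "convex_on X (\<lambda>x. \<Sum>i\<in>I. l i * f i x)"
  using assms
proof (induction I rule: finite_induct)
  case empty
  then show ?case by (simp add: convex_on_const)
next
  case (insert i I)
  then show ?case by (auto intro!: convex_on_add convex_on_cmul)
qed

text \<open>The pairs lying strictly above some (G x, h x) form a convex set that misses the origin.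
  The normal vector of a separating hyperplane supplies the weights.\<close>

lemma convex_alternative_pair:
  fixes G h :: "'a::real_vector \<Rightarrow> real"
  assumes G: "convex_on X G" and h: "convex_on X h"
    and none: "\<And>x. x \<in> X \<Longrightarrow> G x < 0 \<Longrightarrow> h x < 0 \<Longrightarrow> False"
  shows "\<exists>a b. 0 \<le> a \<and> 0 \<le> b \<and> (0 < a \<or> 0 < b) \<and> (\<forall>x\<in>X. 0 \<le> a * G x + b * h x)"
proof (cases "X = {}")
  case True
  then show ?thesis by (intro exI[of _ 1]) auto
next
  case False
  then obtain x0 where x0: "x0 \<in> X" by blast
  define S where "S = {p::real \<times> real. \<exists>x\<in>X. G x < fst p \<and> h x < snd p}"
  have "convex S"
    unfolding convex_alt
  proof (intro ballI allI impI)
    fix p q and t :: real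
    assume p: "p \<in> S" and q: "q \<in> S" and t: "0 \<le> t \<and> t \<le> 1"
    from p obtain x where x: "x \<in> X" "G x < fst p" "h x < snd p" by (auto simp: S_def)
    from q obtain y where y: "y \<in> X" "G y < fst q" "h y < snd q" by (auto simp: S_def)
    have less: "(1 - t) * a + t * b < (1 - t) * a' + t * b'" if "a < a'" "b < b'" for a b a' b' :: real
    proof (cases "t = 0")
      case False
      with t that have "t * b < t * b'" "(1 - t) * a \<le> (1 - t) * a'"
        by (auto intro: mult_left_mono)
      then show ?thesis by linarith
    qed (use that in simp)
    let ?w = "(1 - t) *\<^sub>R x + t *\<^sub>R y"
    have "?w \<in> X"
      using convex_on_imp_convex[OF G] x y t by (auto intro: convexD_alt)
    moreover have "G ?w < fst ((1 - t) *\<^sub>R p + t *\<^sub>R q)"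
      using convex_onD[OF G, of t x y] x y t less[OF x(2) y(2)] by simp
    moreover have "h ?w < snd ((1 - t) *\<^sub>R p + t *\<^sub>R q)"
      using convex_onD[OF h, of t x y] x y t less[OF x(3) y(3)] by simp
    ultimately show "(1 - t) *\<^sub>R p + t *\<^sub>R q \<in> S"
      unfolding S_def by blast
  qed
  moreover have "0 \<notin> S"
    using none by (auto simp: S_def)
  ultimately obtain c where "c \<noteq> 0" and c: "\<And>p. p \<in> S \<Longrightarrow> 0 \<le> inner c p"
    using separating_hyperplane_set_0[of S] by auto
  obtain a b where ab: "c = (a, b)" by (cases c)
  have sep: "0 \<le> a * u + b * v" if "x \<in> X" "G x < u" "h x < v" for x u v
    using c[of "(u, v)"] that by (auto simp: S_def ab)
  \<comment> \<open>\<open>S\<close> is closed under increasing a coordinate. If \<open>a\<close>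
    were negative, a shift by \<open>(\<bar>w\<bar> + 1) / (- a)\<close> would push the functional
    from \<open>w\<close> below 0.\<close>
  have "0 \<le> a"
  proof (rule ccontr)
    assume "\<not> 0 \<le> a"
    define w where "w = a * (G x0 + 1) + b * (h x0 + 1)"
    have "0 < (\<bar>w\<bar> + 1) / (- a)"
      using \<open>\<not> 0 \<le> a\<close> by (intro divide_pos_pos) auto
    have "0 \<le> a * (G x0 + 1 + (\<bar>w\<bar> + 1) / (- a)) + b * (h x0 + 1)"
      using \<open>0 < (\<bar>w\<bar> + 1) / (- a)\<close> by (intro sep[OF x0]) linarith+
    also have "\<dots> = w - (\<bar>w\<bar> + 1)"
      using \<open>\<not> 0 \<le> a\<close> by (simp add: w_def field_simps)
    finally show False by linarith
  qed
  moreover have "0 \<le> b"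
  proof (rule ccontr)
    assume "\<not> 0 \<le> b"
    define w where "w = a * (G x0 + 1) + b * (h x0 + 1)"
    have "0 < (\<bar>w\<bar> + 1) / (- b)"
      using \<open>\<not> 0 \<le> b\<close> by (intro divide_pos_pos) auto
    have "0 \<le> a * (G x0 + 1) + b * (h x0 + 1 + (\<bar>w\<bar> + 1) / (- b))"
      using \<open>0 < (\<bar>w\<bar> + 1) / (- b)\<close> by (intro sep[OF x0]) linarith+
    also have "\<dots> = w - (\<bar>w\<bar> + 1)"
      using \<open>\<not> 0 \<le> b\<close> by (simp add: w_def field_simps)
    finally show False by linarith
  qed
  moreover have "0 < a \<or> 0 < b"
    using \<open>c \<noteq> 0\<close> \<open>0 \<le> a\<close> \<open>0 \<le> b\<close> by (auto simp: ab zero_prod_def)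
  \<comment> \<open>The pair (G x, h x) itself is only a limit of points of \<open>S\<close>, so the
    inequality is obtained up to every \<open>e > 0\<close>.\<close>
  moreover have "0 \<le> a * G x + b * h x" if "x \<in> X" for x
  proof (rule field_le_epsilon)
    fix e :: real assume "e > 0"
    define e' where "e' = e / (a + b)"
    have "a + b > 0" using calculation by linarith
    have "0 \<le> a * (G x + e') + b * (h x + e')"
      using \<open>e > 0\<close> \<open>a + b > 0\<close> by (intro sep[OF that]) (auto simp: e'_def)
    also have "\<dots> = a * G x + b * h x + (a + b) * e'"
      by (simp add: algebra_simps)
    also have "(a + b) * e' = e"
      using \<open>a + b > 0\<close> by (simp add: e'_def)
    finally show "0 \<le> a * G x + b * h x + e" .
  qed
  ultimately show ?thesis by blast
qed

text \<open>Induction on \<open>I\<close>: on the convex set \<open>X'\<close> where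
  \<open>f j\<close> is negative, the other functions have no common point of negativity, so some
  combination of them is nonnegative there. That combination and \<open>f j\<close> are then never
  both negative on \<open>X\<close>, and the case of two functions applies.\<close>

lemma convex_alternative:
  fixes f :: "'i \<Rightarrow> 'a::real_vector \<Rightarrow> real"
  assumes "finite I" "I \<noteq> {}" "\<And>i. i \<in> I \<Longrightarrow> convex_on X (f i)"
    and "\<not> (\<exists>x\<in>X. \<forall>i\<in>I. f i x < 0)"
  shows "\<exists>l. (\<forall>i\<in>I. 0 \<le> l i) \<and> (\<exists>i\<in>I. 0 < l i) \<and> (\<forall>x\<in>X. 0 \<le> (\<Sum>i\<in>I. l i * f i x))"
  using assms
proof (induction I arbitrary: X rule: finite_ne_induct)
  case (singleton j)
  then show ?case by (intro exI[of _ "\<lambda>_. 1"]) (auto simp: not_less)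
next
  case (insert j I)
  have cj: "convex_on X (f j)" and cI: "\<And>i. i \<in> I \<Longrightarrow> convex_on X (f i)"
    using insert.prems(1) by auto
  have "convex X" using convex_on_imp_convex[OF cj] .
  define X' where "X' = {x \<in> X. f j x < 0}"
  have "convex X'"
    unfolding convex_alt X'_def
  proof (intro ballI allI impI)
    fix x y and t :: real
    assume x: "x \<in> {x \<in> X. f j x < 0}" and y: "y \<in> {x \<in> X. f j x < 0}" and t: "0 \<le> t \<and> t \<le> 1"
    have "(1 - t) * f j x + t * f j y < 0"
    proof (cases "t = 0")
      case False
      with t y have "t * f j y < 0" by (simp add: mult_pos_neg)
      moreover have "(1 - t) * f j x \<le> 0" using t x by (simp add: mult_nonneg_nonpos)
      ultimately show ?thesis by linarith
    qed (use x in simp)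
    then have "f j ((1 - t) *\<^sub>R x + t *\<^sub>R y) < 0"
      using convex_onD[OF cj, of t x y] x y t by simp
    then show "(1 - t) *\<^sub>R x + t *\<^sub>R y \<in> {x \<in> X. f j x < 0}"
      using \<open>convex X\<close> x y t by (auto intro: convexD_alt)
  qed
  have "\<And>i. i \<in> I \<Longrightarrow> convex_on X' (f i)"
    by (rule convex_on_subset[OF cI _ \<open>convex X'\<close>]) (auto simp: X'_def)
  moreover have "\<not> (\<exists>x\<in>X'. \<forall>i\<in>I. f i x < 0)"
    using insert.prems(2) by (auto simp: X'_def)
  ultimately obtain l where l: "\<And>i. i \<in> I \<Longrightarrow> 0 \<le> l i" "\<exists>i\<in>I. 0 < l i"
      "\<And>x. x \<in> X' \<Longrightarrow> 0 \<le> (\<Sum>i\<in>I. l i * f i x)"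
    using insert.IH[of X'] by blast
  have "\<exists>a b. 0 \<le> a \<and> 0 \<le> b \<and> (0 < a \<or> 0 < b)
      \<and> (\<forall>x\<in>X. 0 \<le> a * (\<Sum>i\<in>I. l i * f i x) + b * f j x)"
  proof (rule convex_alternative_pair[OF _ cj])
    show "convex_on X (\<lambda>x. \<Sum>i\<in>I. l i * f i x)"
      using insert.hyps(1) \<open>convex X\<close> cI l(1) by (rule convex_on_weighted_sum)
    show False if "x \<in> X" "(\<Sum>i\<in>I. l i * f i x) < 0" "f j x < 0" for x
      using l(3)[of x] that by (simp add: X'_def)
  qed
  then obtain a b where ab: "0 \<le> a" "0 \<le> b" "0 < a \<or> 0 < b"
      "\<And>x. x \<in> X \<Longrightarrow> 0 \<le> a * (\<Sum>i\<in>I. l i * f i x) + b * f j x"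
    by auto
  define l' where "l' i = (if i = j then b else a * l i)" for i
  have "(\<Sum>i\<in>insert j I. l' i * f i x) = a * (\<Sum>i\<in>I. l i * f i x) + b * f j x" for x
  proof -
    have "(\<Sum>i\<in>I. l' i * f i x) = (\<Sum>i\<in>I. a * (l i * f i x))"
      using insert.hyps by (intro sum.cong) (auto simp: l'_def)
    then show ?thesis
      using insert.hyps by (simp add: l'_def sum_distrib_left)
  qed
  then have "\<forall>x\<in>X. 0 \<le> (\<Sum>i\<in>insert j I. l' i * f i x)"
    using ab(4) by simp
  moreover have "\<forall>i\<in>insert j I. 0 \<le> l' i"
    using ab l(1) by (auto simp: l'_def)
  moreover have "\<exists>i\<in>insert j I. 0 < l' i"
  proof (cases "0 < b")
    case False
    then have "0 < a" using ab by simp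
    obtain i where "i \<in> I" "0 < l i" using l(2) by blast
    then have "0 < l' i" using \<open>0 < a\<close> insert.hyps by (auto simp: l'_def)
    then show ?thesis using \<open>i \<in> I\<close> by blast
  qed (auto simp: l'_def)
  ultimately show ?case by blast
qed

section \<open>Error bounds\<close>

text \<open>The ray from the projection \<open>z\<close> of \<open>x\<close> through \<open>x\<close> reaches distance \<open>1\<close> from the zero set at
  a point \<open>w\<close> of a compact set on which \<open>F\<close> is positive; on the segment from \<open>z\<close> to \<open>w\<close>, \<open>F\<close> is an
  increasing polynomial.\<close>
lemma nonneg_convex_zero_bound:
  fixes F :: "'a::euclidean_space \<Rightarrow> real"
  assumes conv: "convex_on UNIV F" and lp: "line_poly d F" and d: "d \<ge> 1" and L: "affine L"
    and nonneg: "\<And>x. x \<in> L \<Longrightarrow> 0 \<le> F x" and z0: "z0 \<in> L" "F z0 = 0"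
  shows "affine {x \<in> L. F x = 0}"
    and "\<exists>c>0. \<forall>x\<in>L. norm x \<le> R \<longrightarrow> (\<exists>z\<in>L. F z = 0 \<and> dist x z ^ d \<le> c * F x)"
proof -
  define Z where "Z = {x \<in> L. F x = 0}"
  have "convex Z"
    unfolding convex_alt
  proof (intro ballI allI impI)
    fix x y and t :: real
    assume "x \<in> Z" "y \<in> Z" and t: "0 \<le> t \<and> t \<le> 1"
    then have xy: "x \<in> L" "F x = 0" "y \<in> L" "F y = 0" by (auto simp: Z_def)
    have "(1 - t) *\<^sub>R x + t *\<^sub>R y \<in> L"
      using L xy by (simp add: affine_alt)
    moreover have "F ((1 - t) *\<^sub>R x + t *\<^sub>R y) \<le> 0"
      using convex_onD[OF conv, of t x y] t xy by simp
    ultimately show "(1 - t) *\<^sub>R x + t *\<^sub>R y \<in> Z"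
      using nonneg by (auto simp: Z_def intro: antisym)
  qed
  then have affZ: "affine Z"
    unfolding Z_def using L lp by (intro affine_zero_set) auto
  then show "affine {x \<in> L. F x = 0}" by (simp add: Z_def)
  have clZ: "closed Z" using affZ by (rule affine_closed)
  have "Z \<noteq> {}" using z0 by (auto simp: Z_def)
  have contF: "continuous_on S F" for S
    using convex_on_continuous[OF open_UNIV conv] continuous_on_subset by blast
  \<comment> \<open>\<open>A\<close> bounds the distance from \<open>x\<close> to its projection on
    \<open>Z\<close>, because \<open>z0\<close> lies in \<open>Z\<close>. The ball in
    \<open>W\<close> is large enough for the point \<open>w\<close> at distance 1 from that
    projection.\<close>
  define A where "A = \<bar>R\<bar> + norm z0"
  define W where "W = L \<inter> cball 0 (\<bar>R\<bar> + A + 1) \<inter> {w. 1 \<le> infdist w Z}"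
  have "compact W"
    unfolding W_def using affine_closed[OF L]
    by (intro compact_Int_closed[of "L \<inter> cball 0 _"] closed_Int_compact closed_Collect_le
        continuous_intros compact_cball)
  have "\<exists>m>0. \<forall>w\<in>W. m \<le> F w"
  proof (cases "W = {}")
    case True
    then show ?thesis by (intro exI[of _ 1]) auto
  next
    case False
    then obtain w0 where w0: "w0 \<in> W" "\<And>w. w \<in> W \<Longrightarrow> F w0 \<le> F w"
      using continuous_attains_inf[OF \<open>compact W\<close> _ contF] by blast
    have "w0 \<notin> Z" using w0(1) by (auto simp: W_def)
    then have "F w0 \<noteq> 0" "0 \<le> F w0" using w0(1) nonneg by (auto simp: W_def Z_def)
    then show ?thesis using w0(2) by (intro exI[of _ "F w0"]) auto
  qed
  then obtain m where "m > 0" and m: "\<And>w. w \<in> W \<Longrightarrow> m \<le> F w" by blast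
  obtain K where "K > 0" and K: "\<And>(q::real poly) s. degree q \<le> d \<Longrightarrow>
     (\<And>u v. 0 \<le> u \<Longrightarrow> u \<le> v \<Longrightarrow> v \<le> 1 \<Longrightarrow> 0 \<le> poly q u \<and> poly q u \<le> poly q v) \<Longrightarrow>
     0 < s \<Longrightarrow> s \<le> 1 \<Longrightarrow> poly q 1 * s ^ d \<le> K * poly q s"
    using increasing_poly_lower_bound[OF d] by blast
  have "A \<ge> 0" by (simp add: A_def)
  show "\<exists>c>0. \<forall>x\<in>L. norm x \<le> R \<longrightarrow> (\<exists>z\<in>L. F z = 0 \<and> dist x z ^ d \<le> c * F x)"
  \<comment> \<open>\<open>K / m\<close> serves the points at distance at most 1 from
    \<open>Z\<close>, \<open>A ^ d / m\<close> the farther ones.\<close>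
  proof (intro exI[of _ "(K + A ^ d) / m"] conjI ballI impI)
    show "0 < (K + A ^ d) / m"
      using \<open>K > 0\<close> \<open>m > 0\<close> \<open>A \<ge> 0\<close> by (simp add: add_pos_nonneg)
    fix x assume "x \<in> L" and nx: "norm x \<le> R"
    obtain z where "z \<in> Z" and z: "\<And>q. q \<in> Z \<Longrightarrow> dist x z \<le> dist x q"
      using distance_attains_inf[OF clZ \<open>Z \<noteq> {}\<close>, of x] by blast
    then have zL: "z \<in> L" and Fz: "F z = 0" by (auto simp: Z_def)
    define s where "s = dist x z"
    have "s \<le> A"
      using z[of z0] z0 nx norm_triangle_ineq4[of x z0] by (simp add: Z_def s_def A_def dist_norm)
    have Fx: "0 \<le> F x" using nonneg \<open>x \<in> L\<close> by blast
    have "s ^ d \<le> (K + A ^ d) / m * F x"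
    proof (cases "s = 0")
      case True
      then show ?thesis
        using Fx \<open>K > 0\<close> \<open>m > 0\<close> \<open>A \<ge> 0\<close> d by (simp add: power_0_left)
    next
      case False
      then have "s > 0" by (simp add: s_def)
      \<comment> \<open>\<open>w\<close> lies beyond \<open>x\<close> if \<open>s < 1\<close> and
        between \<open>z\<close> and \<open>x\<close> if \<open>s > 1\<close>. In both cases
        \<open>x\<close> is the point with parameter \<open>s\<close> on the line from
        \<open>z\<close> through \<open>w\<close>.\<close>
      define w where "w = z + (1 / s) *\<^sub>R (x - z)"
      have pt: "z + u *\<^sub>R (w - z) = (1 - u) *\<^sub>R z + u *\<^sub>R w" for u
        by (simp add: algebra_simps)
      have x_eq: "x = z + s *\<^sub>R (w - z)"
        using \<open>s > 0\<close> by (simp add: w_def)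
      have w_eq: "w = (1 - 1 / s) *\<^sub>R z + (1 / s) *\<^sub>R x"
        by (simp add: w_def algebra_simps)
      have "w \<in> L"
        using L zL \<open>x \<in> L\<close> unfolding w_eq by (simp add: affine_alt)
      have lineL: "z + u *\<^sub>R (w - z) \<in> L" for u
        using L zL \<open>w \<in> L\<close> unfolding pt by (simp add: affine_alt)
      have "norm w \<le> \<bar>R\<bar> + A + 1"
      proof -
        have "norm z \<le> norm x + s"
          using norm_triangle_ineq2[of z x] by (simp add: s_def dist_norm norm_minus_commute)
        moreover have "norm w \<le> norm z + norm ((1 / s) *\<^sub>R (x - z))"
          unfolding w_def by (rule norm_triangle_ineq)
        moreover have "norm ((1 / s) *\<^sub>R (x - z)) = 1"
          using \<open>s > 0\<close> by (simp add: s_def dist_norm)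
        ultimately show ?thesis using nx \<open>s \<le> A\<close> by linarith
      qed
      \<comment> \<open>The homothety with centre \<open>z\<close> and factor \<open>s\<close> maps
        the affine set \<open>Z\<close> into itself and \<open>w\<close> to \<open>x\<close>. A
        point of \<open>Z\<close> closer to \<open>w\<close> than 1 would give one closer to
        \<open>x\<close> than \<open>s\<close>.\<close>
      moreover have "1 \<le> infdist w Z"
      proof -
        obtain q where "q \<in> Z" and q: "infdist w Z = dist w q"
          using infdist_attains_inf[OF clZ \<open>Z \<noteq> {}\<close>] by blast
        have "(1 - s) *\<^sub>R z + s *\<^sub>R q \<in> Z"
          using affZ \<open>z \<in> Z\<close> \<open>q \<in> Z\<close> by (simp add: affine_alt)
        then have "s \<le> dist x ((1 - s) *\<^sub>R z + s *\<^sub>R q)"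
          using z by (simp add: s_def)
        also have "x - ((1 - s) *\<^sub>R z + s *\<^sub>R q) = s *\<^sub>R (w - q)"
          by (subst x_eq) (simp add: algebra_simps)
        then have "dist x ((1 - s) *\<^sub>R z + s *\<^sub>R q) = s * dist w q"
          using \<open>s > 0\<close> by (simp add: dist_norm)
        finally show ?thesis using \<open>s > 0\<close> q by simp
      qed
      ultimately have mw: "m \<le> F w" using \<open>w \<in> L\<close> by (intro m) (simp add: W_def)
      show ?thesis
      proof (cases "s \<le> 1")
        case True
        obtain q where dq: "degree q \<le> d" and q: "\<And>u. F (z + u *\<^sub>R (w - z)) = poly q u"
          using lp unfolding line_poly_def by blast
        have "poly q 1 * s ^ d \<le> K * poly q s"
        proof (rule K[OF dq _ \<open>s > 0\<close> True])
          fix u v :: real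
          assume uv: "0 \<le> u" "u \<le> v" "v \<le> 1"
          have pos: "0 \<le> poly q t" for t
            using nonneg[OF lineL[of t]] by (simp add: q)
          \<comment> \<open>Convexity between the minimum value 0 at \<open>z\<close> and the value
            at parameter \<open>v\<close> makes \<open>q\<close> increasing.\<close>
          have "poly q u \<le> poly q v"
          proof (cases "v = 0")
            case False
            with uv have "v > 0" by simp
            define t where "t = u / v"
            have t: "0 \<le> t" "t \<le> 1" "t * v = u"
              using uv \<open>v > 0\<close> by (auto simp: t_def)
            have "(1 - t) *\<^sub>R z + t *\<^sub>R (z + v *\<^sub>R (w - z)) = z + u *\<^sub>R (w - z)"
              by (simp add: algebra_simps flip: t(3))
            then have "poly q u \<le> (1 - t) * F z + t * poly q v"
              using convex_onD[OF conv t(1,2), of z "z + v *\<^sub>R (w - z)"] by (simp add: q)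
            also have "\<dots> \<le> 1 * poly q v"
              using t pos[of v] Fz by (simp add: mult_left_le_one_le)
            finally show ?thesis by simp
          qed (use uv in simp)
          then show "0 \<le> poly q u \<and> poly q u \<le> poly q v" using pos by blast
        qed
        moreover have "poly q 1 = F w" "poly q s = F x"
          using q[of 1] q[of s] x_eq by (auto simp del: scaleR_right_diff_distrib)
        ultimately have "F w * s ^ d \<le> K * F x" by simp
        moreover have "m * s ^ d \<le> F w * s ^ d"
          using mw \<open>s > 0\<close> by (intro mult_right_mono) auto
        moreover have "0 \<le> A ^ d * F x" using Fx \<open>A \<ge> 0\<close> by simp
        ultimately have "m * s ^ d \<le> (K + A ^ d) * F x" by (simp add: distrib_right)
        then show ?thesis using \<open>m > 0\<close> by (simp add: field_simps)
      next
        case False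
        \<comment> \<open>Here \<open>w\<close> lies between \<open>z\<close> and \<open>x\<close>,
          so \<open>F x\<close> is at least \<open>m\<close>, and the crude bound
          \<open>s \<le> A\<close> suffices.\<close>
        have "F w \<le> (1 - 1 / s) * F z + (1 / s) * F x"
          using convex_onD[OF conv, of "1 / s" z x] False \<open>s > 0\<close> by (simp flip: w_eq)
        also have "\<dots> \<le> 1 * F x"
          using False Fx Fz mult_right_mono[of 1 s "F x"] by (simp add: field_simps)
        finally have "m \<le> F x" using mw by simp
        have "s ^ d \<le> A ^ d" using \<open>s \<le> A\<close> \<open>s > 0\<close> by (intro power_mono) auto
        then have "s ^ d * m \<le> A ^ d * F x"
          using \<open>m \<le> F x\<close> \<open>m > 0\<close> \<open>A \<ge> 0\<close> by (intro mult_mono) auto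
        moreover have "0 \<le> K * F x" using Fx \<open>K > 0\<close> by simp
        ultimately have "m * s ^ d \<le> (K + A ^ d) * F x" by (simp add: algebra_simps)
        then show ?thesis using \<open>m > 0\<close> by (simp add: field_simps)
      qed
    qed
    then show "\<exists>z\<in>L. F z = 0 \<and> dist x z ^ d \<le> (K + A ^ d) / m * F x"
      using zL Fz unfolding s_def by blast
  qed
qed

text \<open>The reflection \<open>w'\<close> of \<open>w\<close> in the zero \<open>z0\<close> has
  the value \<open>- f w\<close>. From any \<open>x\<close>, the segment towards whichever of the
  two has the sign opposite to \<open>f x\<close> meets the zero set after a fraction of its length
  of order |f x|.\<close>

lemma affine_on_zero_bound:
  fixes f :: "'a::euclidean_space \<Rightarrow> real"
  assumes L: "affine L" and lp: "line_poly d f"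
    and aff: "\<And>x y t. x \<in> L \<Longrightarrow> y \<in> L \<Longrightarrow> 0 \<le> t \<Longrightarrow> t \<le> 1 \<Longrightarrow>
      f ((1 - t) *\<^sub>R x + t *\<^sub>R y) = (1 - t) * f x + t * f y"
    and z0: "z0 \<in> L" "f z0 = 0" and w: "w \<in> L" "f w \<noteq> 0"
  shows "affine {x \<in> L. f x = 0}"
    and "\<exists>c>0. \<forall>x\<in>L. norm x \<le> R \<longrightarrow> (\<exists>z\<in>L. f z = 0 \<and> dist x z \<le> c * \<bar>f x\<bar>)"
proof -
  have inL: "(1 - u) *\<^sub>R x + u *\<^sub>R y \<in> L" if "x \<in> L" "y \<in> L" for x y u
    using L that by (simp add: affine_alt)
  have "convex {x \<in> L. f x = 0}"
    unfolding convex_alt using inL aff by auto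
  then show "affine {x \<in> L. f x = 0}"
    using L lp by (intro affine_zero_set)
  define w' where "w' = (1 - 2) *\<^sub>R w + 2 *\<^sub>R z0"
  have w': "w' \<in> L" unfolding w'_def by (rule inL[OF w(1) z0(1)])
  \<comment> \<open>\<open>aff\<close> covers convex combinations only, so the value at the
    reflected point is read off from the midpoint \<open>z0\<close>.\<close>
  have "(1 - 1/2) *\<^sub>R w + (1/2) *\<^sub>R w' = z0"
    by (simp add: w'_def algebra_simps)
  then have fw': "f w' = - f w"
    using aff[OF w(1) w', of "1/2"] z0 by simp
  define \<delta> where "\<delta> = \<bar>f w\<bar>"
  have "\<delta> > 0" using w by (simp add: \<delta>_def)
  define B where "B = \<bar>R\<bar> + norm w + norm w' + 1"
  have "B > 0" by (simp add: B_def add_nonneg_pos)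
  show "\<exists>c>0. \<forall>x\<in>L. norm x \<le> R \<longrightarrow> (\<exists>z\<in>L. f z = 0 \<and> dist x z \<le> c * \<bar>f x\<bar>)"
  proof (intro exI[of _ "B / \<delta>"] conjI ballI impI)
    show "0 < B / \<delta>" using \<open>B > 0\<close> \<open>\<delta> > 0\<close> by simp
    fix x assume x: "x \<in> L" and nx: "norm x \<le> R"
    obtain v where v: "v \<in> L" "v = w \<or> v = w'" "f x * f v \<le> 0" "\<bar>f v\<bar> = \<delta>"
    proof (cases "f x * f w \<le> 0")
      case True
      then show ?thesis using w that[of w] by (simp add: \<delta>_def)
    next
      case False
      then show ?thesis using w' fw' that[of w'] by (simp add: \<delta>_def)
    qed
    \<comment> \<open>The fraction at which an affine function going from \<open>f x\<close> to a
      value of opposite sign and modulus \<open>\<delta>\<close> vanishes.\<close>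
    define t where "t = \<bar>f x\<bar> / (\<bar>f x\<bar> + \<delta>)"
    have t: "0 \<le> t" "t \<le> 1" "t \<le> \<bar>f x\<bar> / \<delta>"
      using \<open>\<delta> > 0\<close> by (auto simp: t_def intro: divide_left_mono)
    have "(\<bar>f x\<bar> + \<delta>) * ((1 - t) * f x + t * f v) = \<delta> * f x + \<bar>f x\<bar> * f v"
    proof -
      have "(\<bar>f x\<bar> + \<delta>) * (1 - t) = \<delta>" "(\<bar>f x\<bar> + \<delta>) * t = \<bar>f x\<bar>"
        using \<open>\<delta> > 0\<close> by (auto simp: t_def field_simps)
      then show ?thesis by (metis distrib_left mult.assoc)
    qed
    also have "\<dots> = 0"
      using v(3) unfolding v(4)[symmetric] by (auto simp: abs_if mult_le_0_iff split: if_splits)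
    finally have "f ((1 - t) *\<^sub>R x + t *\<^sub>R v) = 0"
      using aff[OF x v(1) t(1,2)] \<open>\<delta> > 0\<close> by (simp add: add_nonneg_eq_0_iff)
    moreover have "dist x ((1 - t) *\<^sub>R x + t *\<^sub>R v) \<le> B / \<delta> * \<bar>f x\<bar>"
    proof -
      have "x - ((1 - t) *\<^sub>R x + t *\<^sub>R v) = t *\<^sub>R (x - v)" by (simp add: algebra_simps)
      then have "dist x ((1 - t) *\<^sub>R x + t *\<^sub>R v) = t * norm (x - v)"
        using t by (simp add: dist_norm)
      also have "\<dots> \<le> (\<bar>f x\<bar> / \<delta>) * B"
      proof (intro mult_mono)
        have "norm v \<le> norm w + norm w'" using v(2) by auto
        then show "norm (x - v) \<le> B"
          using norm_triangle_ineq4[of x v] nx unfolding B_def by linarith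
      qed (use t \<open>\<delta> > 0\<close> in auto)
      finally show ?thesis by (simp add: mult.commute)
    qed
    ultimately show "\<exists>z\<in>L. f z = 0 \<and> dist x z \<le> B / \<delta> * \<bar>f x\<bar>"
      using inL[OF x v(1)] by blast
  qed
qed

text \<open>Moving from \<open>x\<close> towards the Slater point by the fraction t = e / (e +
  \<delta>) brings each constraint to at most (1 - t) e - t \<delta> = 0, and the move has length of
  order \<open>e\<close>.\<close>

lemma slater_error_bound:
  fixes f :: "'i \<Rightarrow> 'a::real_normed_vector \<Rightarrow> real"
  assumes I: "finite I" and L: "convex L" and conv: "\<And>i. i \<in> I \<Longrightarrow> convex_on L (f i)"
    and x0: "x0 \<in> L" "\<And>i. i \<in> I \<Longrightarrow> f i x0 < 0"
  shows "\<exists>c>0. \<forall>x\<in>L. \<forall>e>0. norm x \<le> R \<longrightarrow> (\<forall>i\<in>I. f i x \<le> e) \<longrightarrow>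
           (\<exists>s\<in>L. (\<forall>i\<in>I. f i s \<le> 0) \<and> dist x s \<le> c * e)"
proof -
  have "\<exists>\<delta>>0. \<forall>i\<in>I. f i x0 \<le> - \<delta>"
  proof (cases "I = {}")
    case False
    have "Max ((\<lambda>i. f i x0) ` I) < 0"
      using I False x0(2) by simp
    then show ?thesis
      using I by (intro exI[of _ "- Max ((\<lambda>i. f i x0) ` I)"]) auto
  qed (auto intro: exI[of _ 1])
  then obtain \<delta> where "\<delta> > 0" and \<delta>: "\<And>i. i \<in> I \<Longrightarrow> f i x0 \<le> - \<delta>" by blast
  define B where "B = \<bar>R\<bar> + norm x0 + 1"
  have "B > 0" by (simp add: B_def add_nonneg_pos)
  show ?thesis
  proof (intro exI[of _ "B / \<delta>"] conjI ballI allI impI)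
    show "0 < B / \<delta>" using \<open>B > 0\<close> \<open>\<delta> > 0\<close> by simp
    fix x and e :: real
    assume x: "x \<in> L" and e: "e > 0" and nx: "norm x \<le> R" and fx: "\<forall>i\<in>I. f i x \<le> e"
    define t where "t = e / (e + \<delta>)"
    have t: "0 \<le> t" "t \<le> 1" "t \<le> e / \<delta>"
      using \<open>\<delta> > 0\<close> e by (auto simp: t_def intro: divide_left_mono)
    have "f i ((1 - t) *\<^sub>R x + t *\<^sub>R x0) \<le> 0" if "i \<in> I" for i
    proof -
      have "f i ((1 - t) *\<^sub>R x + t *\<^sub>R x0) \<le> (1 - t) * f i x + t * f i x0"
        using conv[OF that] t x x0(1) by (intro convex_onD) auto
      also have "\<dots> \<le> (1 - t) * e + t * (- \<delta>)"
        using t fx \<delta>[OF that] that by (intro add_mono mult_left_mono) auto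
      also have "\<dots> = 0"
        using \<open>\<delta> > 0\<close> e by (simp add: t_def field_simps)
      finally show ?thesis .
    qed
    moreover have "(1 - t) *\<^sub>R x + t *\<^sub>R x0 \<in> L"
      using L x x0 t by (intro convexD_alt) auto
    moreover have "dist x ((1 - t) *\<^sub>R x + t *\<^sub>R x0) \<le> B / \<delta> * e"
    proof -
      have "x - ((1 - t) *\<^sub>R x + t *\<^sub>R x0) = t *\<^sub>R (x - x0)" by (simp add: algebra_simps)
      then have "dist x ((1 - t) *\<^sub>R x + t *\<^sub>R x0) = t * norm (x - x0)"
        using t by (simp add: dist_norm)
      also have "\<dots> \<le> (e / \<delta>) * B"
      proof (intro mult_mono)
        show "norm (x - x0) \<le> B"
          using norm_triangle_ineq4[of x x0] nx unfolding B_def by linarith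
      qed (use t \<open>\<delta> > 0\<close> e in auto)
      finally show ?thesis by (simp add: mult.commute)
    qed
    ultimately show "\<exists>s\<in>L. (\<forall>i\<in>I. f i s \<le> 0) \<and> dist x s \<le> B / \<delta> * e" by blast
  qed
qed

section \<open>Facial reduction and Hoelder error bounds\<close>

lemma powr_le_powr_bounded:
  fixes e :: real
  assumes "0 < e" "e \<le> R" "a \<le> b"
  shows "e powr b \<le> R powr (b - a) * e powr a"
proof -
  have "e powr b = e powr (b - a) * e powr a"
    by (simp flip: powr_add)
  also have "\<dots> \<le> R powr (b - a) * e powr a"
    using assms by (intro mult_right_mono powr_mono2) auto
  finally show ?thesis .
qed

lemma le_powr_of_power_le:
  fixes a y :: real
  assumes "0 \<le> a" "a ^ d \<le> y" "d \<ge> 1"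
  shows "a \<le> y powr (1 / real d)"
proof (cases "a = 0")
  case False
  then have "a = (a ^ d) powr (1 / real d)"
    using assms by (simp add: powr_realpow[symmetric] powr_powr)
  also have "\<dots> \<le> y powr (1 / real d)"
    using assms by (intro powr_mono2) auto
  finally show ?thesis .
qed simp

lemma convex_on_UNIV_lipschitz_finite:
  fixes f :: "'i \<Rightarrow> 'a::euclidean_space \<Rightarrow> real"
  assumes "finite I" "\<And>i. i \<in> I \<Longrightarrow> convex_on UNIV (f i)"
  shows "\<exists>c>0. \<forall>i\<in>I. \<forall>x y. norm x \<le> R \<longrightarrow> norm y \<le> R \<longrightarrow> f i y \<le> f i x + c * dist x y"
proof -
  have "\<exists>c. \<forall>i\<in>I. c i > 0 \<and> (\<forall>x y. norm x \<le> R \<longrightarrow> norm y \<le> R \<longrightarrow> f i y \<le> f i x + c i * dist x y)"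
    using convex_on_UNIV_lipschitz[OF assms(2)] by (intro bchoice) blast
  then obtain c where c: "\<And>i. i \<in> I \<Longrightarrow> c i > 0"
    "\<And>i x y. i \<in> I \<Longrightarrow> norm x \<le> R \<Longrightarrow> norm y \<le> R \<Longrightarrow> f i y \<le> f i x + c i * dist x y"
    by blast
  show ?thesis
  proof (intro exI[of _ "1 + sum c I"] conjI ballI allI impI)
    show "0 < 1 + sum c I"
      using c(1) by (intro add_pos_nonneg sum_nonneg) (auto intro: less_imp_le)
    fix i and x y :: 'a
    assume i: "i \<in> I" and xy: "norm x \<le> R" "norm y \<le> R"
    have "c i \<le> sum c I"
      using assms(1) i c(1) by (intro member_le_sum) (auto intro: less_imp_le)
    then have "c i * dist x y \<le> (1 + sum c I) * dist x y"
      by (intro mult_right_mono) auto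
    then show "f i y \<le> f i x + (1 + sum c I) * dist x y"
      using c(2)[OF i xy] by linarith
  qed
qed

text \<open>Induction on \<open>k + card I\<close>. A Slater point gives a linear bound. Otherwise,
  either the problem moves to a proper affine subspace through \<open>s0\<close>, which lowers
  \<open>k\<close> and costs a factor \<open>d\<close> in the exponent, or a constraint vanishing on
  \<open>L\<close> is dropped, which lowers \<open>card I\<close> and costs nothing.
  \<open>R\<close> varies because both points and levels grow on the way.\<close>

lemma convex_system_error_bound:
  fixes f :: "'i \<Rightarrow> 'a::euclidean_space \<Rightarrow> real"
  assumes d: "d \<ge> 1"
  shows "finite I \<Longrightarrow> affine L \<Longrightarrow> aff_dim L \<le> int k \<Longrightarrow>
    (\<And>i. i \<in> I \<Longrightarrow> convex_on UNIV (f i)) \<Longrightarrow> (\<And>i. i \<in> I \<Longrightarrow> line_poly d (f i)) \<Longrightarrow>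
    s0 \<in> L \<Longrightarrow> (\<And>i. i \<in> I \<Longrightarrow> f i s0 \<le> 0) \<Longrightarrow>
    \<exists>c>0. \<forall>x\<in>L. \<forall>e. norm x \<le> R \<longrightarrow> 0 < e \<longrightarrow> e \<le> R \<longrightarrow> (\<forall>i\<in>I. f i x \<le> e) \<longrightarrow>
      (\<exists>s\<in>L. (\<forall>i\<in>I. f i s \<le> 0) \<and> dist x s \<le> c * e powr (1 / real d ^ k))"
proof (induction "k + card I" arbitrary: k I L R rule: less_induct)
  case less
  note I = \<open>finite I\<close> and L = \<open>affine L\<close> and conv = less.prems(4) and lp = less.prems(5)
    and s0 = \<open>s0 \<in> L\<close> less.prems(7)
  have dk: "1 / real d ^ j \<le> 1 / real d ^ i" if "i \<le> j" for i j
    using d that by (intro divide_left_mono power_increasing) auto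
  have d1: "1 / real d \<le> 1" "0 < 1 / real d" using d by auto
  have conv': "convex_on L (f i)" if "i \<in> I" for i
    using convex_on_subset[OF conv[OF that] subset_UNIV affine_imp_convex[OF L]] .
  show ?case
  proof (cases "R \<le> 0")
    case True
    then show ?thesis by (intro exI[of _ 1]) auto
  next
    case False
    then have "R > 0" by simp
    show ?thesis
    proof (cases "\<exists>x0\<in>L. \<forall>i\<in>I. f i x0 < 0")
      case True
      then obtain x0 where x0: "x0 \<in> L" "\<And>i. i \<in> I \<Longrightarrow> f i x0 < 0" by blast
      obtain c where "c > 0" and c: "\<And>x e. x \<in> L \<Longrightarrow> e > 0 \<Longrightarrow> norm x \<le> R \<Longrightarrow> (\<forall>i\<in>I. f i x \<le> e) \<Longrightarrow>
           \<exists>s\<in>L. (\<forall>i\<in>I. f i s \<le> 0) \<and> dist x s \<le> c * e"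
        using slater_error_bound[where f=f and R=R, OF I affine_imp_convex[OF L] conv' x0] by blast
      show ?thesis
      proof (intro exI[of _ "c * R powr (1 - 1 / real d ^ k)"] conjI ballI allI impI)
        show "0 < c * R powr (1 - 1 / real d ^ k)" using \<open>c > 0\<close> \<open>R > 0\<close> by simp
        fix x e assume x: "x \<in> L" "norm x \<le> R" "0 < e" "e \<le> R" "\<forall>i\<in>I. f i x \<le> e"
        then obtain s where s: "s \<in> L" "\<forall>i\<in>I. f i s \<le> 0" "dist x s \<le> c * e"
          using c by blast
        have "e powr 1 \<le> R powr (1 - 1 / real d ^ k) * e powr (1 / real d ^ k)"
          using x dk[of 0 k] by (intro powr_le_powr_bounded) auto
        then have "c * e \<le> c * (R powr (1 - 1 / real d ^ k) * e powr (1 / real d ^ k))"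
          using \<open>c > 0\<close> x by (intro mult_left_mono) auto
        then show "\<exists>s\<in>L. (\<forall>i\<in>I. f i s \<le> 0) \<and>
            dist x s \<le> c * R powr (1 - 1 / real d ^ k) * e powr (1 / real d ^ k)"
          using s by (intro bexI[of _ s]) (auto simp: mult.assoc)
      qed
    next
      case no_slater: False
      then have "I \<noteq> {}" using s0 by auto
      \<comment> \<open>\<open>x\<close> is first moved to some \<open>z\<close> in \<open>Z\<close>
        at distance of order e^(1/d). By the Lipschitz bound the constraints at \<open>z\<close> are
        at most \<open>e'\<close>, again of order e^(1/d), and the induction hypothesis with
        exponent 1/d^j turns this into e^(1/d^k) for k = j + 1.\<close>
      have reduce: ?thesis
        if Z: "affine Z" "Z \<subseteq> L" "Z \<noteq> L" "s0 \<in> Z" and "c1 > 0"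
          and proj: "\<And>x e. x \<in> L \<Longrightarrow> norm x \<le> R \<Longrightarrow> 0 < e \<Longrightarrow> e \<le> R \<Longrightarrow> \<forall>i\<in>I. f i x \<le> e \<Longrightarrow>
            \<exists>z\<in>Z. dist x z \<le> c1 * e powr (1 / real d)" for Z c1
      proof -
        have "aff_dim Z < aff_dim L"
          using Z L by (intro aff_dim_psubset) (auto simp: hull_same)
        moreover have "0 \<le> aff_dim Z"
          using Z(4) aff_dim_negative_iff[of Z] by (metis empty_iff not_less)
        ultimately obtain j where k: "k = Suc j" and j: "aff_dim Z \<le> int j"
          using less.prems(3) by (cases k) auto
        define R0 where "R0 = R + c1 * R powr (1 / real d)"
        obtain c2 where "c2 > 0" and c2: "\<And>i x y. i \<in> I \<Longrightarrow> norm x \<le> R0 \<Longrightarrow> norm y \<le> R0 \<Longrightarrow>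
            f i y \<le> f i x + c2 * dist x y"
          using convex_on_UNIV_lipschitz_finite[where f=f and R=R0, OF I conv] by blast
        define M where "M = R powr (1 - 1 / real d) + c2 * c1"
        have "M > 0" using \<open>R > 0\<close> \<open>c1 > 0\<close> \<open>c2 > 0\<close> by (simp add: M_def add_pos_pos)
        \<comment> \<open>The induction hypothesis uses one radius for points and levels:
          \<open>R0\<close> bounds the norm of \<open>z\<close>, the other term bounds
          \<open>e'\<close>.\<close>
        define R1 where "R1 = max R0 (M * R powr (1 / real d))"
        have "\<exists>c>0. \<forall>x\<in>Z. \<forall>e. norm x \<le> R1 \<longrightarrow> 0 < e \<longrightarrow> e \<le> R1 \<longrightarrow> (\<forall>i\<in>I. f i x \<le> e) \<longrightarrow>
            (\<exists>s\<in>Z. (\<forall>i\<in>I. f i s \<le> 0) \<and> dist x s \<le> c * e powr (1 / real d ^ j))"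
          using less.hyps[of j I Z R1] k I Z j conv lp s0 by auto
        then obtain c3 where "c3 > 0" and c3: "\<And>x e. x \<in> Z \<Longrightarrow> norm x \<le> R1 \<Longrightarrow> 0 < e \<Longrightarrow> e \<le> R1 \<Longrightarrow>
            \<forall>i\<in>I. f i x \<le> e \<Longrightarrow>
            \<exists>s\<in>Z. (\<forall>i\<in>I. f i s \<le> 0) \<and> dist x s \<le> c3 * e powr (1 / real d ^ j)"
          by blast
        show ?thesis
        proof (intro exI[of _ "c1 * R powr (1 / real d - 1 / real d ^ k) + c3 * M powr (1 / real d ^ j)"]
            conjI ballI allI impI)
          show "0 < c1 * R powr (1 / real d - 1 / real d ^ k) + c3 * M powr (1 / real d ^ j)"
            using \<open>c1 > 0\<close> \<open>c3 > 0\<close> \<open>M > 0\<close> \<open>R > 0\<close> by (simp add: add_pos_pos)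
          fix x e assume x: "x \<in> L" "norm x \<le> R" and e: "0 < e" "e \<le> R" and fx: "\<forall>i\<in>I. f i x \<le> e"
          obtain z where z: "z \<in> Z" "dist x z \<le> c1 * e powr (1 / real d)"
            using proj[OF x e fx] by blast
          have eR: "e powr (1 / real d) \<le> R powr (1 / real d)"
            using e d1 by (intro powr_mono2) auto
          then have "c1 * e powr (1 / real d) \<le> c1 * R powr (1 / real d)"
            using \<open>c1 > 0\<close> by (intro mult_left_mono) auto
          moreover have "norm z - norm x \<le> dist x z"
            using norm_triangle_ineq2[of z x] by (simp add: dist_norm norm_minus_commute)
          moreover have "0 \<le> c1 * R powr (1 / real d)"
            using \<open>c1 > 0\<close> by simp
          ultimately have nz: "norm z \<le> R0" and nx: "norm x \<le> R0"
            using z(2) x(2) unfolding R0_def by linarith+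
          define e' where "e' = M * e powr (1 / real d)"
          have "f i z \<le> e'" if "i \<in> I" for i
          proof -
            have "f i z \<le> f i x + c2 * dist x z" using c2[OF that nx nz] .
            also have "\<dots> \<le> e powr 1 + c2 * (c1 * e powr (1 / real d))"
              using fx that z(2) \<open>c2 > 0\<close> e by (intro add_mono mult_left_mono) auto
            also have "e powr 1 \<le> R powr (1 - 1 / real d) * e powr (1 / real d)"
              using e d1 by (intro powr_le_powr_bounded)
            finally show ?thesis by (simp add: e'_def M_def algebra_simps)
          qed
          moreover have "0 < e'" using \<open>M > 0\<close> e by (simp add: e'_def)
          moreover have "e' \<le> R1"
            unfolding e'_def R1_def using eR \<open>M > 0\<close> by (intro max.coboundedI2 mult_left_mono) auto
          moreover have "norm z \<le> R1" using nz by (simp add: R1_def)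
          ultimately obtain s where s: "s \<in> Z" "\<forall>i\<in>I. f i s \<le> 0" "dist z s \<le> c3 * e' powr (1 / real d ^ j)"
            using c3[OF z(1), of e'] by blast
          have "e' powr (1 / real d ^ j) = M powr (1 / real d ^ j) * e powr (1 / real d ^ k)"
            using \<open>M > 0\<close> e by (simp add: e'_def powr_mult powr_powr k)
          then have "dist z s \<le> c3 * M powr (1 / real d ^ j) * e powr (1 / real d ^ k)"
            using s(3) by (simp add: mult.assoc)
          moreover have "e powr (1 / real d) \<le> R powr (1 / real d - 1 / real d ^ k) * e powr (1 / real d ^ k)"
            using e dk[of 1 k] k by (intro powr_le_powr_bounded) auto
          then have "c1 * e powr (1 / real d) \<le> c1 * (R powr (1 / real d - 1 / real d ^ k) * e powr (1 / real d ^ k))"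
            using \<open>c1 > 0\<close> by (intro mult_left_mono) auto
          ultimately have "dist x s \<le>
              (c1 * R powr (1 / real d - 1 / real d ^ k) + c3 * M powr (1 / real d ^ j)) * e powr (1 / real d ^ k)"
            using z(2) dist_triangle[of x s z] by (simp add: algebra_simps)
          then show "\<exists>s\<in>L. (\<forall>i\<in>I. f i s \<le> 0) \<and> dist x s \<le>
              (c1 * R powr (1 / real d - 1 / real d ^ k) + c3 * M powr (1 / real d ^ j)) * e powr (1 / real d ^ k)"
            using s Z by blast
        qed
      qed
      \<comment> \<open>The resulting combination \<open>F\<close> is nonnegative on
        \<open>L\<close> but nonpositive at the solution \<open>s0\<close>, hence zero there. Its
        zero set is the first candidate for \<open>Z\<close>.\<close>
      obtain l where l: "\<And>i. i \<in> I \<Longrightarrow> 0 \<le> l i" "\<exists>i\<in>I. 0 < l i"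
          "\<And>x. x \<in> L \<Longrightarrow> 0 \<le> (\<Sum>i\<in>I. l i * f i x)"
        using convex_alternative[where f=f, OF I \<open>I \<noteq> {}\<close> conv' no_slater] by blast
      define F where "F x = (\<Sum>i\<in>I. l i * f i x)" for x
      have Fpos: "0 \<le> F x" if "x \<in> L" for x using l(3) that by (simp add: F_def)
      have "F s0 \<le> 0"
        unfolding F_def using l(1) s0 by (intro sum_nonpos) (auto intro: mult_nonneg_nonpos)
      then have Fs0: "F s0 = 0" using Fpos[OF s0(1)] by linarith
      define \<Lambda> where "\<Lambda> = sum l I"
      have "\<Lambda> > 0"
        unfolding \<Lambda>_def using l(1,2) I by (metis sum_pos2)
      show ?thesis
      proof (cases "\<exists>x\<in>L. F x \<noteq> 0")
        case True
        have cF: "convex_on UNIV F"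
          unfolding F_def using I conv l(1) by (intro convex_on_weighted_sum) auto
        have lF: "line_poly d F"
          unfolding F_def using I lp by (intro line_poly_sum)
        note zb = nonneg_convex_zero_bound[OF cF lF d L Fpos s0(1) Fs0]
        obtain c where "c > 0" and c: "\<And>x. x \<in> L \<Longrightarrow> norm x \<le> R \<Longrightarrow> \<exists>z\<in>L. F z = 0 \<and> dist x z ^ d \<le> c * F x"
          using zb(2)[of R] by blast
        show ?thesis
        \<comment> \<open>From \<open>F x \<le> \<Lambda> * e\<close> the d-th power of the distance
          is at most \<open>c * \<Lambda> * e\<close>; the constant is what the d-th root
          leaves.\<close>
        proof (rule reduce[OF zb(1), of "(c * \<Lambda>) powr (1 / real d)"])
          show "{x \<in> L. F x = 0} \<noteq> L" using True by auto
          show "0 < (c * \<Lambda>) powr (1 / real d)" using \<open>c > 0\<close> \<open>\<Lambda> > 0\<close> by simp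
          fix x e assume x: "x \<in> L" "norm x \<le> R" "0 < e" "e \<le> R" "\<forall>i\<in>I. f i x \<le> e"
          obtain z where z: "z \<in> L" "F z = 0" "dist x z ^ d \<le> c * F x"
            using c x by blast
          have "F x \<le> (\<Sum>i\<in>I. l i * e)"
            unfolding F_def using x l(1) by (intro sum_mono mult_left_mono) auto
          then have "c * F x \<le> c * (\<Lambda> * e)"
            using \<open>c > 0\<close> by (simp add: \<Lambda>_def sum_distrib_right)
          then have "dist x z \<le> (c * \<Lambda> * e) powr (1 / real d)"
            using z(3) d by (intro le_powr_of_power_le) auto
          then show "\<exists>z\<in>{x \<in> L. F x = 0}. dist x z \<le> (c * \<Lambda>) powr (1 / real d) * e powr (1 / real d)"
            using z \<open>c > 0\<close> \<open>\<Lambda> > 0\<close> x by (auto simp: powr_mult)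
        qed (use s0 Fs0 in auto)
      next
        case False
        then have F0: "F x = 0" if "x \<in> L" for x using that by blast
        obtain j where j: "j \<in> I" "0 < l j" using l(2) by blast
        \<comment> \<open>The convexity gaps of the \<open>f i\<close>, weighted by
          \<open>l i\<close>, are nonnegative and sum to the gap of \<open>F\<close>, which is 0. So
          each weighted gap vanishes, and positive weight makes \<open>f j\<close> affine on
          \<open>L\<close>.\<close>
        have aff: "f j ((1 - t) *\<^sub>R x + t *\<^sub>R y) = (1 - t) * f j x + t * f j y"
          if xy: "x \<in> L" "y \<in> L" and t: "0 \<le> t" "t \<le> 1" for x y t
        proof -
          define w where "w = (1 - t) *\<^sub>R x + t *\<^sub>R y"
          have "w \<in> L" using L xy by (simp add: affine_alt w_def)
          define D where "D i = l i * ((1 - t) * f i x + t * f i y - f i w)" for i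
          have "(\<Sum>i\<in>I. D i) = (1 - t) * F x + t * F y - F w"
            by (simp add: D_def F_def algebra_simps sum.distrib sum_subtractf sum_distrib_left)
          then have "(\<Sum>i\<in>I. D i) = 0" using F0 xy \<open>w \<in> L\<close> by simp
          moreover have "0 \<le> D i" if "i \<in> I" for i
            using l(1)[OF that] convex_onD[OF conv[OF that] t, of x y] by (simp add: D_def w_def)
          ultimately have "D j = 0" using I j by (simp add: sum_nonneg_eq_0_iff)
          then show ?thesis using j by (simp add: D_def w_def)
        qed
        have "f j s0 = 0"
        proof -
          have "(\<Sum>i\<in>I. - (l i * f i s0)) = 0" using Fs0 by (simp add: F_def sum_negf)
          moreover have "0 \<le> - (l i * f i s0)" if "i \<in> I" for i
            using l(1) s0 that by (simp add: mult_nonneg_nonpos)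
          ultimately have "- (l j * f j s0) = 0" using I j(1) by (simp add: sum_nonneg_eq_0_iff)
          then show ?thesis using j by simp
        qed
        show ?thesis
        proof (cases "\<exists>w\<in>L. f j w \<noteq> 0")
          case False
          \<comment> \<open>\<open>f j\<close> vanishes on \<open>L\<close>, so leaving it out does
            not change the solutions in \<open>L\<close>; the exponent stays and the measure drops
            through \<open>card I\<close>.\<close>
          have "card (I - {j}) < card I" using I j by (intro psubset_card_mono) auto
          then have "\<exists>c>0. \<forall>x\<in>L. \<forall>e. norm x \<le> R \<longrightarrow> 0 < e \<longrightarrow> e \<le> R \<longrightarrow> (\<forall>i\<in>I - {j}. f i x \<le> e) \<longrightarrow>
              (\<exists>s\<in>L. (\<forall>i\<in>I - {j}. f i s \<le> 0) \<and> dist x s \<le> c * e powr (1 / real d ^ k))"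
            using less.prems by (intro less.hyps) auto
          then obtain c where "c > 0" and c: "\<And>x e. x \<in> L \<Longrightarrow> norm x \<le> R \<Longrightarrow> 0 < e \<Longrightarrow> e \<le> R \<Longrightarrow>
              \<forall>i\<in>I - {j}. f i x \<le> e \<Longrightarrow>
              \<exists>s\<in>L. (\<forall>i\<in>I - {j}. f i s \<le> 0) \<and> dist x s \<le> c * e powr (1 / real d ^ k)"
            by blast
          show ?thesis
          proof (intro exI[of _ c] conjI ballI allI impI)
            fix x e assume x: "x \<in> L" "norm x \<le> R" "0 < e" "e \<le> R" "\<forall>i\<in>I. f i x \<le> e"
            then obtain s where s: "s \<in> L" "\<forall>i\<in>I - {j}. f i s \<le> 0" "dist x s \<le> c * e powr (1 / real d ^ k)"
              using c[of x e] by blast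
            have "f j s = 0" using False s(1) by blast
            then have "\<forall>i\<in>I. f i s \<le> 0" using s(2) by (metis DiffI order_refl singletonD)
            then show "\<exists>s\<in>L. (\<forall>i\<in>I. f i s \<le> 0) \<and> dist x s \<le> c * e powr (1 / real d ^ k)"
              using s by blast
          qed (rule \<open>c > 0\<close>)
        next
          case True
          then obtain w where w: "w \<in> L" "f j w \<noteq> 0" by blast
          note zb = affine_on_zero_bound[OF L lp[OF j(1)] aff s0(1) \<open>f j s0 = 0\<close> w]
          obtain c where "c > 0" and c: "\<And>x. x \<in> L \<Longrightarrow> norm x \<le> R \<Longrightarrow>
              \<exists>z\<in>L. f j z = 0 \<and> dist x z \<le> c * \<bar>f j x\<bar>"
            using zb(2)[of R] by blast
          define c' where "c' = 1 + \<Lambda> / l j"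
          have "c' > 0" using j \<open>\<Lambda> > 0\<close> by (simp add: c'_def add_pos_pos)
          show ?thesis
          proof (rule reduce[OF zb(1), of "c * c' * R powr (1 - 1 / real d)"])
            show "{x \<in> L. f j x = 0} \<noteq> L" using w by auto
            show "0 < c * c' * R powr (1 - 1 / real d)"
              using \<open>c > 0\<close> \<open>c' > 0\<close> \<open>R > 0\<close> by simp
            fix x e assume x: "x \<in> L" "norm x \<le> R" "0 < e" "e \<le> R" "\<forall>i\<in>I. f i x \<le> e"
            obtain z where z: "z \<in> L" "f j z = 0" "dist x z \<le> c * \<bar>f j x\<bar>"
              using c x by blast
            \<comment> \<open>The hypothesis bounds \<open>f j x\<close> only from above. The lower
              bound comes from \<open>F x = 0\<close>: a very negative \<open>f j x\<close> would
              have to be balanced by the other terms, which are at most \<open>\<Lambda> * e\<close>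
              together.\<close>
            have "\<bar>f j x\<bar> \<le> c' * e"
            proof -
              have "F x = l j * f j x + (\<Sum>i\<in>I - {j}. l i * f i x)"
                unfolding F_def using I j by (simp add: sum.remove)
              moreover have "(\<Sum>i\<in>I - {j}. l i * f i x) \<le> (\<Sum>i\<in>I - {j}. l i * e)"
                using x l(1) by (intro sum_mono mult_left_mono) auto
              moreover have "\<dots> \<le> (\<Sum>i\<in>I. l i * e)"
                using I x l(1) by (intro sum_mono2) auto
              ultimately have "- (l j * f j x) \<le> \<Lambda> * e"
                using F0[OF x(1)] by (simp add: \<Lambda>_def sum_distrib_right)
              then have "- f j x \<le> \<Lambda> / l j * e" using j by (simp add: field_simps)
              moreover have "f j x \<le> e" using x j by blast
              moreover have "0 \<le> \<Lambda> / l j * e" using x j \<open>\<Lambda> > 0\<close> by simp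
              ultimately show ?thesis using x(3) by (simp add: c'_def algebra_simps abs_le_iff)
            qed
            then have "c * \<bar>f j x\<bar> \<le> c * (c' * e powr 1)"
              using \<open>c > 0\<close> x by (intro mult_left_mono) auto
            also have "\<dots> \<le> c * (c' * (R powr (1 - 1 / real d) * e powr (1 / real d)))"
              using x d1 \<open>c > 0\<close> \<open>c' > 0\<close> by (intro mult_left_mono powr_le_powr_bounded) auto
            finally show "\<exists>z\<in>{x \<in> L. f j x = 0}. dist x z \<le> c * c' * R powr (1 - 1 / real d) * e powr (1 / real d)"
              using z by (intro bexI[of _ z]) (auto simp: mult.assoc)
          qed (use s0 \<open>f j s0 = 0\<close> in auto)
        qed
      qed
    qed
  qed
qed

text \<open>The levels of the constraints are replaced by distances: a feasible point for
  \<open>f i\<close> within \<open>e\<close> of \<open>x\<close> bounds \<open>f i x\<close> by a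
  multiple of \<open>e\<close>, by the Lipschitz estimate. Stating the conclusion with a power of
  the distance includes \<open>e = 0\<close> and removes real exponents.\<close>

lemma convex_system_hoelder_regular:
  fixes f :: "'i \<Rightarrow> 'a::euclidean_space \<Rightarrow> real"
  assumes d: "d \<ge> 1" and I: "finite I" and conv: "\<And>i. i \<in> I \<Longrightarrow> convex_on UNIV (f i)"
    and lp: "\<And>i. i \<in> I \<Longrightarrow> line_poly d (f i)" and s0: "\<And>i. i \<in> I \<Longrightarrow> f i s0 \<le> 0"
  shows "\<exists>c>0. \<forall>x e. norm x \<le> R \<longrightarrow> 0 \<le> e \<longrightarrow> e \<le> R \<longrightarrow> (\<forall>i\<in>I. \<exists>p. dist x p \<le> e \<and> f i p \<le> 0) \<longrightarrow>
    (\<exists>s. (\<forall>i\<in>I. f i s \<le> 0) \<and> dist x s ^ (d ^ DIM('a)) \<le> c * e)"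
proof -
  let ?N = "d ^ DIM('a)"
  \<comment> \<open>The radius is doubled because the nearby feasible points lie within
    \<open>e \<le> R\<close> of \<open>x\<close>.\<close>
  obtain c1 where "c1 > 0" and c1: "\<And>i x y. i \<in> I \<Longrightarrow> norm x \<le> 2 * R \<Longrightarrow> norm y \<le> 2 * R \<Longrightarrow>
      f i y \<le> f i x + c1 * dist x y"
    using convex_on_UNIV_lipschitz_finite[where f=f and R="2 * R", OF I conv] by blast
  have "aff_dim (UNIV :: 'a set) \<le> int DIM('a)" by (simp add: aff_dim_UNIV)
  note bound = convex_system_error_bound[where f=f and k="DIM('a)" and R="max R (c1 * R)",
        OF d I affine_UNIV this conv lp UNIV_I s0, unfolded ball_UNIV bex_UNIV]
  obtain c2 where "c2 > 0" and c2: "\<And>x e. norm x \<le> max R (c1 * R) \<Longrightarrow> 0 < e \<Longrightarrow> e \<le> max R (c1 * R) \<Longrightarrow>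
      \<forall>i\<in>I. f i x \<le> e \<Longrightarrow> \<exists>s. (\<forall>i\<in>I. f i s \<le> 0) \<and> dist x s \<le> c2 * e powr (1 / real d ^ DIM('a))"
    using bound by blast
  show ?thesis
  proof (intro exI[of _ "c2 ^ ?N * c1"] conjI allI impI)
    show "0 < c2 ^ ?N * c1" using \<open>c1 > 0\<close> \<open>c2 > 0\<close> by simp
    fix x e
    assume nx: "norm x \<le> R" and e: "0 \<le> e" "e \<le> R" and ap: "\<forall>i\<in>I. \<exists>p. dist x p \<le> e \<and> f i p \<le> 0"
    have fx: "f i x \<le> c1 * e" if i: "i \<in> I" for i
    proof -
      obtain p where p: "dist x p \<le> e" "f i p \<le> 0" using ap i by blast
      have "norm p - norm x \<le> dist x p"
        using norm_triangle_ineq2[of p x] by (simp add: dist_norm norm_minus_commute)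
      then have "norm p \<le> 2 * R" "norm x \<le> 2 * R"
        using p(1) nx e by linarith+
      then have "f i x \<le> f i p + c1 * dist p x" using c1[OF that] by blast
      also have "\<dots> \<le> 0 + c1 * e"
        using p \<open>c1 > 0\<close> by (intro add_mono mult_left_mono) (auto simp: dist_commute)
      finally show ?thesis by simp
    qed
    show "\<exists>s. (\<forall>i\<in>I. f i s \<le> 0) \<and> dist x s ^ ?N \<le> c2 ^ ?N * c1 * e"
    proof (cases "e = 0")
      case True
      then show ?thesis using fx d by (intro exI[of _ x]) (auto simp: power_0_left)
    next
      case False
      then have "0 < c1 * e" using e \<open>c1 > 0\<close> by simp
      moreover have "c1 * e \<le> max R (c1 * R)"
        using e \<open>c1 > 0\<close> by (intro max.coboundedI2 mult_left_mono) auto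
      moreover have "norm x \<le> max R (c1 * R)" using nx by linarith
      ultimately obtain s where s: "\<forall>i\<in>I. f i s \<le> 0" "dist x s \<le> c2 * (c1 * e) powr (1 / real d ^ DIM('a))"
        using c2[of x "c1 * e"] fx by blast
      have "dist x s ^ ?N \<le> (c2 * (c1 * e) powr (1 / real d ^ DIM('a))) ^ ?N"
        using s by (intro power_mono) auto
      also have "\<dots> = c2 ^ ?N * ((c1 * e) powr (1 / real d ^ DIM('a))) ^ ?N"
        by (rule power_mult_distrib)
      also have "((c1 * e) powr (1 / real d ^ DIM('a))) ^ ?N = ((c1 * e) powr (1 / real d ^ DIM('a))) powr real ?N"
        using \<open>0 < c1 * e\<close> by (intro powr_realpow[symmetric]) auto
      also have "\<dots> = c1 * e"
        using \<open>0 < c1 * e\<close> d by (simp add: powr_powr)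
      finally show ?thesis using s by (auto simp: mult.assoc)
    qed
  qed
qed

section \<open>Convergence rates\<close>

lemma linear_recurrence_rate:
  fixes b :: "nat \<Rightarrow> real"
  assumes nonneg: "\<And>t. 0 \<le> b t" and \<kappa>: "\<kappa> > 0" and rec: "\<And>t. b (Suc t) \<le> b t - \<kappa> * b t"
  shows "\<exists>r. 0 < r \<and> r < 1 \<and> (\<forall>t. b t \<le> b 0 * r ^ t)"
proof -
  \<comment> \<open>The maximum keeps \<open>r\<close> positive even if
    \<open>\<kappa> \<ge> 1\<close>.\<close>
  define r where "r = max (1/2) (1 - \<kappa>)"
  have r: "0 < r" "r < 1" using \<kappa> by (auto simp: r_def)
  have "b t \<le> b 0 * r ^ t" for t
  proof (induction t)
    case (Suc t)
    have "b (Suc t) \<le> (1 - \<kappa>) * b t" using rec[of t] by (simp add: algebra_simps)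
    also have "\<dots> \<le> r * b t" using nonneg[of t] by (intro mult_right_mono) (auto simp: r_def)
    also have "\<dots> \<le> r * (b 0 * r ^ t)" using Suc r by (intro mult_left_mono) auto
    finally show ?case by (simp add: algebra_simps)
  qed simp
  then show ?thesis using r by blast
qed

text \<open>With \<open>u = \<kappa> b\<^sub>t\<^sup>p\<close> the recursion gives \<open>u' \<le> u (1 - u)\<close>, and \<open>t u \<le> 1\<close> implies
  \<open>(t + 1) u (1 - u) \<le> (1 - u) + u (1 - u) = 1 - u\<^sup>2\<close>.\<close>
lemma power_recurrence_rate:
  fixes b :: "nat \<Rightarrow> real"
  assumes nonneg: "\<And>t. 0 \<le> b t" and \<kappa>: "\<kappa> > 0" and p: "p \<ge> 1"
    and rec: "\<And>t. b (Suc t) \<le> b t - \<kappa> * b t ^ Suc p"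
  shows "real t * (\<kappa> * b t ^ p) \<le> 1"
proof (induction t)
  case (Suc t)
  define u where "u = \<kappa> * b t ^ p"
  have u0: "0 \<le> u" using \<kappa> nonneg[of t] by (simp add: u_def)
  have step: "b (Suc t) \<le> b t * (1 - u)"
    using rec[of t] by (simp add: u_def algebra_simps)
  \<comment> \<open>A larger \<open>u\<close> would make \<open>b (Suc t)\<close> negative, unless
    \<open>b t = 0\<close>, where \<open>u\<close> is 0 because \<open>p \<ge> 1\<close>.\<close>
  have u1: "u \<le> 1"
  proof (cases "b t = 0")
    case True
    then show ?thesis using p by (simp add: u_def power_0_left)
  next
    case False
    then have "b t > 0" using nonneg[of t] by simp
    moreover have "0 \<le> b t * (1 - u)" using step nonneg[of "Suc t"] by linarith
    ultimately show ?thesis by (simp add: zero_le_mult_iff)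
  qed
  have "b (Suc t) ^ p \<le> (b t * (1 - u)) ^ p"
    using step nonneg[of "Suc t"] by (intro power_mono)
  also have "\<dots> = b t ^ p * (1 - u) ^ p" by (rule power_mult_distrib)
  also have "\<dots> \<le> b t ^ p * (1 - u) ^ 1"
    using u0 u1 p nonneg[of t] by (intro mult_left_mono power_decreasing) auto
  finally have "\<kappa> * b (Suc t) ^ p \<le> u * (1 - u)"
    using \<kappa> by (simp add: u_def mult.assoc)
  then have "real (Suc t) * (\<kappa> * b (Suc t) ^ p) \<le> real (Suc t) * (u * (1 - u))"
    by (intro mult_left_mono) auto
  also have "\<dots> = (real t * u) * (1 - u) + u * (1 - u)"
    by (simp add: algebra_simps)
  also have "\<dots> \<le> 1 * (1 - u) + u * (1 - u)"
    using Suc u1 by (intro add_right_mono mult_right_mono) (auto simp: u_def)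
  also have "\<dots> = 1 - u\<^sup>2" by (simp add: algebra_simps power2_eq_square)
  finally show ?case by (smt (verit) zero_le_power2)
qed simp

text \<open>All later iterates stay as close as \<open>x t\<close> to the point of \<open>S\<close>
  nearest to \<open>x t\<close>, hence within twice the distance of \<open>x t\<close> to
  \<open>S\<close> from \<open>x t\<close> itself. This gives the Cauchy property and, in the limit,
  the error bound.\<close>

lemma fejer_monotone_convergence:
  fixes x :: "nat \<Rightarrow> 'a::euclidean_space"
  assumes S: "closed S" "S \<noteq> {}"
    and fejer: "\<And>s t. s \<in> S \<Longrightarrow> dist (x (Suc t)) s \<le> dist (x t) s"
    and lim: "(\<lambda>t. infdist (x t) S) \<longlonglongrightarrow> 0"
  shows "\<exists>l\<in>S. x \<longlonglongrightarrow> l \<and> (\<forall>t. dist (x t) l \<le> 2 * infdist (x t) S)"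
proof -
  define \<delta> where "\<delta> t = infdist (x t) S" for t
  have near: "\<exists>s\<in>S. dist (x t) s = \<delta> t" for t
    using infdist_attains_inf[OF S, of "x t"] unfolding \<delta>_def by metis
  have mono: "dist (x (t + k)) s \<le> dist (x t) s" if "s \<in> S" for s t k
  proof (induction k)
    case (Suc k)
    then show ?case using fejer[OF that, of "t + k"] by simp
  qed simp
  have close: "dist (x (t + k)) (x t) \<le> 2 * \<delta> t" for t k
  proof -
    obtain s where s: "s \<in> S" "dist (x t) s = \<delta> t" using near by blast
    show ?thesis
      using mono[OF s(1), of t k] s(2) dist_triangle2[of "x (t + k)" "x t" s] by linarith
  qed
  have "Cauchy x"
    unfolding Cauchy_altdef
  proof (intro allI impI)
    fix e :: real assume "e > 0"
    then have "\<forall>\<^sub>F t in sequentially. \<delta> t < e / 4"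
      using lim unfolding \<delta>_def by (intro order_tendstoD(2)) auto
    then obtain T where T: "\<And>t. t \<ge> T \<Longrightarrow> \<delta> t < e / 4"
      unfolding eventually_sequentially by blast
    show "\<exists>M. \<forall>m\<ge>M. \<forall>n>m. dist (x m) (x n) < e"
    proof (intro exI[of _ T] allI impI)
      fix m n assume "m \<ge> T" "n > m"
      then show "dist (x m) (x n) < e"
        using close[of m "n - m"] T[of m] \<open>e > 0\<close> by (simp add: dist_commute)
    qed
  qed
  then obtain l where l: "x \<longlonglongrightarrow> l" using Cauchy_convergent convergent_def by blast
  have bound: "dist (x t) l \<le> 2 * \<delta> t" for t
  proof -
    have "(\<lambda>k. dist (x (k + t)) (x t)) \<longlonglongrightarrow> dist l (x t)"
      using l by (intro tendsto_intros LIMSEQ_ignore_initial_segment)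
    then have "dist l (x t) \<le> 2 * \<delta> t"
      by (rule LIMSEQ_le_const2) (use close[of t] in \<open>auto simp: add.commute\<close>)
    then show ?thesis by (simp add: dist_commute)
  qed
  have "(\<lambda>t. infdist (x t) S) \<longlonglongrightarrow> infdist l S"
    using l by (intro tendsto_infdist)
  then have "infdist l S = 0" using lim LIMSEQ_unique by blast
  then have "l \<in> S" using S in_closed_iff_infdist_zero by blast
  then show ?thesis using l bound unfolding \<delta>_def by blast
qed

section \<open>Decrease of the squared distance in one damped Douglas-Rachford step\<close>

lemma norm_convex_comb_square_le:
  fixes a b :: "'a::real_inner"
  assumes "0 \<le> u" "u \<le> 1"
  shows "(norm ((1 - u) *\<^sub>R a + u *\<^sub>R b))\<^sup>2 \<le> (1 - u) * (norm a)\<^sup>2 + u * (norm b)\<^sup>2"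
proof -
  have "(norm ((1 - u) *\<^sub>R a + u *\<^sub>R b))\<^sup>2
      = (1 - u) * (norm a)\<^sup>2 + u * (norm b)\<^sup>2 - u * (1 - u) * (norm (a - b))\<^sup>2"
    unfolding power2_norm_eq_inner
    by (simp add: inner_add_left inner_add_right inner_diff_left inner_diff_right inner_commute algebra_simps)
  then show ?thesis using assms by simp
qed

text \<open>Expanding the square leaves the cross term
  \<open>2 * \<beta> * inner (x - p) (s - p)\<close>, which is nonpositive because \<open>p\<close>
  is the projection of \<open>x\<close>. The coefficient \<beta> (2 - \<beta>) is positive for 0 <
  \<beta> < 2.\<close>

lemma relaxed_projection_fejer:
  fixes A :: "'a::euclidean_space set"
  assumes "convex A" "closed A" "s \<in> A" "0 \<le> \<beta>"
  shows "(norm (x + \<beta> *\<^sub>R (closest_point A x - x) - s))\<^sup>2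
    \<le> (norm (x - s))\<^sup>2 - \<beta> * (2 - \<beta>) * (dist x (closest_point A x))\<^sup>2"
proof -
  define p where "p = closest_point A x"
  have "inner (x - p) (s - p) \<le> 0"
    using closest_point_dot[OF assms(1-3)] by (simp add: p_def)
  moreover have "(norm (x + \<beta> *\<^sub>R (p - x) - s))\<^sup>2
      = (norm (x - s))\<^sup>2 - \<beta> * (2 - \<beta>) * (norm (x - p))\<^sup>2 + 2 * \<beta> * inner (x - p) (s - p)"
    unfolding power2_norm_eq_inner
    by (simp add: inner_add_left inner_add_right inner_diff_left inner_diff_right inner_commute algebra_simps)
  ultimately show ?thesis
    using mult_nonneg_nonpos[of "2 * \<beta>" "inner (x - p) (s - p)"] assms(4)
    by (simp add: p_def dist_norm)
qed

lemma reflected_damped_proj: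
  assumes "\<eta> > 0"
  shows "2 *\<^sub>R damped_proj \<eta> A v - v = v + (4 * \<eta> / (2 * \<eta> + 1)) *\<^sub>R (closest_point A v - v)"
proof -
  have "2 / (2 * \<eta> + 1) - 1 = 1 - 4 * \<eta> / (2 * \<eta> + 1)"
    using assms by (simp add: field_simps)
  then have "(2 / (2 * \<eta> + 1)) *\<^sub>R v - v = v - (4 * \<eta> / (2 * \<eta> + 1)) *\<^sub>R v"
    by (metis scaleR_left_diff_distrib scaleR_one)
  then show ?thesis
    by (simp add: damped_proj_def scaleR_add_right scaleR_diff_right)
qed

text \<open>Let \<open>w\<close> and \<open>v\<close> be the successive relaxed reflections of
  \<open>x\<close> for \<open>C\<close> and \<open>D\<close>. They gain \<beta> (2 - \<beta>) times
  a^2 and b^2, where \<open>a\<close> is the distance of \<open>x\<close> to \<open>C\<close> and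
  \<open>b\<close> that of \<open>w\<close> to \<open>D\<close>. As \<open>w\<close> is within
  \<open>2 * a\<close> of \<open>x\<close>, the larger distance of \<open>x\<close> to the two sets
  is at most \<open>2 * a + b\<close>.\<close>

lemma damped_douglas_rachford_step:
  fixes C D :: "(real ^ 'n) set"
  assumes C: "convex C" "closed C" and D: "convex D" "closed D" and s: "s \<in> C" "s \<in> D"
    and \<eta>: "\<eta> > 0" and \<mu>: "0 < \<mu>" "\<mu> \<le> 2"
    and y: "y = damped_proj \<eta> C x" and z: "z = damped_proj \<eta> D (2 *\<^sub>R y - x)"
    and x': "x' = x + \<mu> *\<^sub>R (z - y)"
  shows "(norm (x' - s))\<^sup>2 \<le> (norm (x - s))\<^sup>2
    - \<mu> * (4 * \<eta> / (5 * (2 * \<eta> + 1)\<^sup>2)) * (max (dist x (closest_point C x)) (dist x (closest_point D x)))\<^sup>2"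
proof -
  define \<beta> where "\<beta> = 4 * \<eta> / (2 * \<eta> + 1)"
  have \<beta>: "0 \<le> \<beta>" "\<beta> \<le> 2" using \<eta> by (auto simp: \<beta>_def field_simps)
  have \<beta>2: "\<beta> * (2 - \<beta>) = 8 * \<eta> / (2 * \<eta> + 1)\<^sup>2"
    using \<eta> by (simp add: \<beta>_def field_simps power2_eq_square)
  define w where "w = 2 *\<^sub>R y - x"
  define v where "v = 2 *\<^sub>R z - w"
  have w: "w = x + \<beta> *\<^sub>R (closest_point C x - x)"
    using reflected_damped_proj[OF \<eta>, of C x] by (simp add: w_def y \<beta>_def)
  have v: "v = w + \<beta> *\<^sub>R (closest_point D w - w)"
    using reflected_damped_proj[OF \<eta>, of D w] by (simp add: v_def z w_def[symmetric] \<beta>_def)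
  define a where "a = dist x (closest_point C x)"
  define b where "b = dist w (closest_point D w)"
  define e where "e = max a (dist x (closest_point D x))"
  \<comment> \<open>Hence \<open>x'\<close> is a convex combination of \<open>x\<close> and
    \<open>v\<close> with weight \<open>\<mu> / 2\<close>, which is where
    \<open>\<mu> \<le> 2\<close> enters.\<close>
  have zy: "z - y = (1/2) *\<^sub>R (v - x)"
    by (simp add: v_def w_def algebra_simps flip: scaleR_2)
  have x's: "x' - s = (1 - \<mu> / 2) *\<^sub>R (x - s) + (\<mu> / 2) *\<^sub>R (v - s)"
    unfolding x' zy by (simp add: algebra_simps)
  have "dist x w \<le> 2 * a"
  proof -
    have "dist x w = \<beta> * a"
      using \<beta> by (simp add: w a_def dist_norm norm_minus_commute)
    then show ?thesis using \<beta> by (simp add: a_def mult_right_mono)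
  qed
  moreover have "dist x (closest_point D x) \<le> dist x (closest_point D w)"
    using D s by (intro closest_point_le closest_point_in_set) auto
  moreover have "dist x (closest_point D w) \<le> dist x w + b"
    unfolding b_def by (rule dist_triangle)
  moreover have "0 \<le> a" "0 \<le> b" by (auto simp: a_def b_def)
  ultimately have "e \<le> 2 * a + b" by (simp add: e_def)
  moreover have "0 \<le> e" using \<open>0 \<le> a\<close> by (simp add: e_def)
  ultimately have "e\<^sup>2 \<le> (2 * a + b)\<^sup>2" by (intro power_mono)
  \<comment> \<open>Cauchy-Schwarz for the vectors (2, 1) and (a, b), with its defect made
    explicit.\<close>
  also have "\<dots> = 5 * (a\<^sup>2 + b\<^sup>2) - (a - 2 * b)\<^sup>2"
    by (simp add: power2_eq_square algebra_simps)
  also have "\<dots> \<le> 5 * (a\<^sup>2 + b\<^sup>2)" by simp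
  finally have ab: "e\<^sup>2 / 5 \<le> a\<^sup>2 + b\<^sup>2" by simp
  have "(norm (w - s))\<^sup>2 \<le> (norm (x - s))\<^sup>2 - \<beta> * (2 - \<beta>) * a\<^sup>2"
    unfolding w a_def using C s \<beta> by (intro relaxed_projection_fejer)
  moreover have "(norm (v - s))\<^sup>2 \<le> (norm (w - s))\<^sup>2 - \<beta> * (2 - \<beta>) * b\<^sup>2"
    unfolding v b_def using D s \<beta> by (intro relaxed_projection_fejer)
  moreover have "\<beta> * (2 - \<beta>) * (e\<^sup>2 / 5) \<le> \<beta> * (2 - \<beta>) * (a\<^sup>2 + b\<^sup>2)"
    using ab \<beta> by (intro mult_left_mono) auto
  ultimately have "(norm (v - s))\<^sup>2 \<le> (norm (x - s))\<^sup>2 - \<beta> * (2 - \<beta>) * (e\<^sup>2 / 5)"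
    by (simp add: algebra_simps)
  then have "(\<mu> / 2) * (norm (v - s))\<^sup>2 \<le> (\<mu> / 2) * ((norm (x - s))\<^sup>2 - \<beta> * (2 - \<beta>) * (e\<^sup>2 / 5))"
    using \<mu> by (intro mult_left_mono) auto
  then have "(\<mu> / 2) * (norm (v - s))\<^sup>2
      \<le> (\<mu> / 2) * (norm (x - s))\<^sup>2 - (\<mu> / 2) * (\<beta> * (2 - \<beta>) * (e\<^sup>2 / 5))"
    unfolding right_diff_distrib .
  moreover have "(norm (x' - s))\<^sup>2 \<le> (1 - \<mu> / 2) * (norm (x - s))\<^sup>2 + (\<mu> / 2) * (norm (v - s))\<^sup>2"
    unfolding x's using \<mu> by (intro norm_convex_comb_square_le) auto
  moreover have "(1 - \<mu> / 2) * (norm (x - s))\<^sup>2 = (norm (x - s))\<^sup>2 - (\<mu> / 2) * (norm (x - s))\<^sup>2"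
    by (simp add: left_diff_distrib)
  moreover have "(\<mu> / 2) * (\<beta> * (2 - \<beta>) * (e\<^sup>2 / 5)) = \<mu> * (4 * \<eta> / (5 * (2 * \<eta> + 1)\<^sup>2)) * e\<^sup>2"
    unfolding \<beta>2 by (simp add: ac_simps)
  ultimately have "(norm (x' - s))\<^sup>2 \<le> (norm (x - s))\<^sup>2 - \<mu> * (4 * \<eta> / (5 * (2 * \<eta> + 1)\<^sup>2)) * e\<^sup>2"
    by linarith
  then show ?thesis unfolding e_def a_def .
qed

section \<open>Comparison of exponents, and sublevel sets of convex polynomials\<close>

lemma power_mean_two:
  fixes a :: real
  assumes "a \<ge> 1"
  shows "2 * a ^ n \<le> (2 * a - 1) ^ n + 1"
proof (induction n)
  case (Suc n)
  have "(2 * a - 1) * (2 * a ^ n - 1) \<le> (2 * a - 1) * (2 * a - 1) ^ n"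
    using Suc assms by (intro mult_left_mono) auto
  moreover have "0 \<le> (a ^ n - 1) * (a - 1)"
    using assms by (intro mult_nonneg_nonneg) (auto simp: one_le_power)
  ultimately show ?case by (simp add: algebra_simps)
qed simp

text \<open>For one term of the minimum the central binomial coefficient is at least 1; for the
  other, \<open>d\<close> is the midpoint of 1 and 2d - 1, and the n-th power is convex there. So a
  rate with exponent \<open>d ^ n\<close> implies the one with \<gamma>.\<close>

lemma degree_power_le_inverse_rate_gamma:
  assumes "d \<ge> 1"
  shows "real d ^ n \<le> inverse (rate_gamma n d)"
proof -
  have "1 \<le> central_binom (n - 1)"
    unfolding central_binom_def by (simp add: Suc_leI)
  then have "1 * real d ^ n \<le> real (central_binom (n - 1)) * real d ^ n"
    by (intro mult_right_mono) auto
  moreover have "2 * real d ^ n \<le> (2 * real d - 1) ^ n + 1"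
    using assms by (intro power_mean_two) auto
  ultimately show ?thesis unfolding rate_gamma_def by simp
qed

lemma closed_sublevel_set:
  assumes "\<And>i. i \<in> {1..m} \<Longrightarrow> convex_poly (g i)"
  shows "closed (sublevel_set m g)"
proof -
  have "closed {x. poly_fun (g i) x \<le> 0}" if "i \<in> {1..m}" for i
    using assms[OF that] unfolding convex_poly_def
    by (intro closed_Collect_le convex_on_continuous continuous_on_const) auto
  moreover have "sublevel_set m g = (\<Inter>i\<in>{1..m}. {x. poly_fun (g i) x \<le> 0})"
    by (auto simp: sublevel_set_def)
  ultimately show ?thesis by auto
qed

lemma convex_sublevel_set:
  assumes "\<And>i. i \<in> {1..m} \<Longrightarrow> convex_poly (g i)"
  shows "convex (sublevel_set m g)"
  unfolding convex_alt sublevel_set_def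
proof (intro ballI allI impI CollectI)
  fix x y i and t :: real
  assume x: "x \<in> {x. \<forall>i\<in>{1..m}. poly_fun (g i) x \<le> 0}"
    and y: "y \<in> {x. \<forall>i\<in>{1..m}. poly_fun (g i) x \<le> 0}" and t: "0 \<le> t \<and> t \<le> 1" and i: "i \<in> {1..m}"
  have "poly_fun (g i) ((1 - t) *\<^sub>R x + t *\<^sub>R y) \<le> (1 - t) * poly_fun (g i) x + t * poly_fun (g i) y"
    using assms[OF i] t unfolding convex_poly_def by (intro convex_onD) auto
  also have "\<dots> \<le> 0"
    using x y t i by (intro add_nonpos_nonpos mult_nonneg_nonpos) auto
  finally show "poly_fun (g i) ((1 - t) *\<^sub>R x + t *\<^sub>R y) \<le> 0" .
qed

text \<open>Decrease and regularity combine to b' \<le> b - \<kappa> b^N for the squared distance b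
  to \<open>S\<close>, with \<kappa> = K / c^2. This yields geometric decay for N = 1 and b^(N - 1)
  \<le> 1 / (\<kappa> t) otherwise; Fejer monotonicity transfers the rate to the distance from the
  limit.\<close>

lemma fejer_monotone_hoelder_rate:
  fixes x :: "nat \<Rightarrow> 'a::euclidean_space"
  assumes S: "closed S" "S \<noteq> {}" and "K > 0" "c > 0" and N: "N \<ge> 1"
    and step: "\<And>s t. s \<in> S \<Longrightarrow> (norm (x (Suc t) - s))\<^sup>2 \<le> (norm (x t - s))\<^sup>2 - K * (e t)\<^sup>2"
    and reg: "\<And>t. \<exists>s\<in>S. dist (x t) s ^ N \<le> c * e t"
  shows "\<exists>l\<in>S. x \<longlonglongrightarrow> l \<and>
    (N = 1 \<longrightarrow> (\<exists>M>0. \<exists>r. 0 < r \<and> r < 1 \<and> (\<forall>t. norm (x t - l) \<le> M * r ^ t))) \<and>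
    (N > 1 \<longrightarrow> (\<exists>M>0. \<forall>t\<ge>1. norm (x t - l) \<le> M * real t powr (- (1 / (2 * (real N - 1))))))"
proof -
  define \<delta> where "\<delta> t = infdist (x t) S" for t
  have \<delta>0: "0 \<le> \<delta> t" for t by (simp add: \<delta>_def infdist_nonneg)
  define \<kappa> where "\<kappa> = K / c\<^sup>2"
  have "\<kappa> > 0" using \<open>K > 0\<close> \<open>c > 0\<close> by (simp add: \<kappa>_def)
  have rec: "(\<delta> (Suc t))\<^sup>2 \<le> (\<delta> t)\<^sup>2 - \<kappa> * ((\<delta> t)\<^sup>2) ^ N" for t
  proof -
    obtain s where s: "s \<in> S" "dist (x t) s = \<delta> t"
      using infdist_attains_inf[OF S, of "x t"] unfolding \<delta>_def by metis
    \<comment> \<open>Two points of \<open>S\<close> are involved: the decrease is measured at the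
      nearest point \<open>s\<close>, while \<open>s'\<close> only bounds the distance to
      \<open>S\<close> from above.\<close>
    obtain s' where s': "s' \<in> S" "dist (x t) s' ^ N \<le> c * e t" using reg by blast
    have "\<delta> t ^ N \<le> dist (x t) s' ^ N"
      using s'(1) \<delta>0 by (intro power_mono) (auto simp: \<delta>_def infdist_le)
    then have "\<delta> t ^ N \<le> c * e t" using s'(2) by linarith
    then have "(\<delta> t ^ N)\<^sup>2 \<le> (c * e t)\<^sup>2" using \<delta>0 by (intro power_mono) auto
    then have "((\<delta> t)\<^sup>2) ^ N \<le> c\<^sup>2 * (e t)\<^sup>2"
      by (simp add: power_mult_distrib mult.commute flip: power_mult)
    then have "\<kappa> * ((\<delta> t)\<^sup>2) ^ N \<le> \<kappa> * (c\<^sup>2 * (e t)\<^sup>2)"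
      using \<open>\<kappa> > 0\<close> by (intro mult_left_mono) auto
    also have "\<dots> = K * (e t)\<^sup>2" using \<open>c > 0\<close> by (simp add: \<kappa>_def)
    finally have "\<kappa> * ((\<delta> t)\<^sup>2) ^ N \<le> K * (e t)\<^sup>2" .
    moreover have "(\<delta> (Suc t))\<^sup>2 \<le> (norm (x (Suc t) - s))\<^sup>2"
      using s(1) infdist_le[OF s(1), of "x (Suc t)"] \<delta>0 by (intro power_mono) (auto simp: \<delta>_def dist_norm)
    ultimately show ?thesis
      using step[OF s(1), of t] s(2) by (simp add: dist_norm)
  qed
  have fejer: "dist (x (Suc t)) s \<le> dist (x t) s" if "s \<in> S" for s t
  proof -
    have "0 \<le> K * (e t)\<^sup>2" using \<open>K > 0\<close> by simp
    then have "(norm (x (Suc t) - s))\<^sup>2 \<le> (norm (x t - s))\<^sup>2" using step[OF that, of t] by linarith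
    then show ?thesis unfolding dist_norm by (rule power2_le_imp_le) simp
  qed
  have conv: "\<exists>l\<in>S. x \<longlonglongrightarrow> l \<and> (\<forall>t. norm (x t - l) \<le> 2 * \<delta> t)" if "\<delta> \<longlonglongrightarrow> 0"
    using fejer_monotone_convergence[where x=x, OF S fejer] that unfolding \<delta>_def dist_norm by blast
  show ?thesis
  proof (cases "N = 1")
    case True
    have "(\<delta> (Suc t))\<^sup>2 \<le> (\<delta> t)\<^sup>2 - \<kappa> * (\<delta> t)\<^sup>2" for t using rec[of t] True by simp
    then obtain r where r: "0 < r" "r < 1" "\<And>t. (\<delta> t)\<^sup>2 \<le> (\<delta> 0)\<^sup>2 * r ^ t"
      using linear_recurrence_rate[of "\<lambda>t. (\<delta> t)\<^sup>2" \<kappa>] \<open>\<kappa> > 0\<close> by auto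
    define q where "q = sqrt r"
    have q: "0 < q" "q < 1" using r by (auto simp: q_def)
    have \<delta>q: "\<delta> t \<le> \<delta> 0 * q ^ t" for t
    proof -
      have "(\<delta> t)\<^sup>2 \<le> (\<delta> 0 * q ^ t)\<^sup>2"
      proof -
        have "(q ^ t)\<^sup>2 = (q\<^sup>2) ^ t" by (simp add: mult.commute flip: power_mult)
        then have "(q ^ t)\<^sup>2 = r ^ t" using r(1) by (simp add: q_def)
        then show ?thesis using r(3)[of t] by (simp add: power_mult_distrib)
      qed
      then show ?thesis using \<delta>0[of 0] q by (auto elim!: power2_le_imp_le)
    qed
    have "(\<lambda>t. \<delta> 0 * q ^ t) \<longlonglongrightarrow> 0"
      using q by (intro tendsto_mult_right_zero LIMSEQ_power_zero) auto
    then have "\<delta> \<longlonglongrightarrow> 0"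
      by (rule Lim_null_comparison[rotated]) (use \<delta>0 \<delta>q in auto)
    then obtain l where l: "l \<in> S" "x \<longlonglongrightarrow> l" "\<And>t. norm (x t - l) \<le> 2 * \<delta> t" using conv by blast
    \<comment> \<open>The summand 1 keeps the constant positive if the sequence starts in
      \<open>S\<close>.\<close>
    have "norm (x t - l) \<le> (2 * \<delta> 0 + 1) * q ^ t" for t
    proof -
      have "norm (x t - l) \<le> 2 * (\<delta> 0 * q ^ t) + q ^ t"
        using l(3)[of t] \<delta>q[of t] zero_le_power[of q t] q(1) by linarith
      then show ?thesis by (simp add: algebra_simps)
    qed
    moreover have "2 * \<delta> 0 + 1 > 0" using \<delta>0[of 0] by simp
    ultimately show ?thesis using l q True by blast
  next
    case False
    define p where "p = N - 1"
    have p: "p \<ge> 1" "N = Suc p" using N False by (auto simp: p_def)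
    \<comment> \<open>The constant left by the root of order \<open>2 * p\<close> in \<delta>^(2p)
      \<le> 1 / (\<kappa> t).\<close>
    define M where "M = (1 / \<kappa>) powr (1 / real (2 * p))"
    have "M > 0" using \<open>\<kappa> > 0\<close> by (simp add: M_def)
    have \<delta>M: "\<delta> t \<le> M * real t powr (- (1 / real (2 * p)))" if "t \<ge> 1" for t
    proof -
      have "real t * (\<kappa> * ((\<delta> t)\<^sup>2) ^ p) \<le> 1"
        using \<open>\<kappa> > 0\<close> p rec by (intro power_recurrence_rate) auto
      then have "((\<delta> t)\<^sup>2) ^ p \<le> 1 / \<kappa> * (1 / real t)"
        using \<open>\<kappa> > 0\<close> that by (simp add: field_simps)
      then have "\<delta> t ^ (2 * p) \<le> 1 / \<kappa> * (1 / real t)"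
        by (simp only: power_mult)
      then have "\<delta> t \<le> (1 / \<kappa> * (1 / real t)) powr (1 / real (2 * p))"
        using \<delta>0 p by (intro le_powr_of_power_le) auto
      also have "\<dots> = M * real t powr (- (1 / real (2 * p)))"
        using \<open>\<kappa> > 0\<close> that by (simp only: powr_mult M_def) (simp add: powr_minus_divide powr_divide)
      finally show ?thesis .
    qed
    have "(\<lambda>t. M * real t powr (- (1 / real (2 * p)))) \<longlonglongrightarrow> 0"
      using p by (intro tendsto_mult_right_zero tendsto_neg_powr filterlim_real_sequentially) auto
    moreover have "\<forall>\<^sub>F t in sequentially. \<delta> t \<le> M * real t powr (- (1 / real (2 * p)))"
      using \<delta>M eventually_ge_at_top[of 1] by (rule eventually_mono[rotated])
    ultimately have "\<delta> \<longlonglongrightarrow> 0"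
      using \<delta>0 by (intro Lim_null_comparison[of \<delta>]) auto
    then obtain l where l: "l \<in> S" "x \<longlonglongrightarrow> l" "\<And>t. norm (x t - l) \<le> 2 * \<delta> t" using conv by blast
    have "real (2 * p) = 2 * (real N - 1)" using p by simp
    then have "norm (x t - l) \<le> 2 * M * real t powr (- (1 / (2 * (real N - 1))))" if "t \<ge> 1" for t
      using l(3)[of t] \<delta>M[OF that] by simp
    then show ?thesis
      using l False \<open>M > 0\<close> by (intro bexI[of _ l] conjI impI exI[of _ "2 * M"]) auto
  qed
qed

section \<open>Convergence and rate for convex polynomial constraints\<close>

theorem theorem5p5:
  fixes g h :: "nat \<Rightarrow> ('n::finite) rpoly"
    and m1 m2 d :: nat
    and C D :: "(real ^ 'n) set"
    and \<eta> :: real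
    and lam :: "nat \<Rightarrow> real"
    and x y z :: "nat \<Rightarrow> real ^ 'n"
  assumes "d \<ge> 1"
    and "\<And>i. i \<in> {1..m1} \<Longrightarrow> convex_poly (g i) \<and> total_deg (g i) \<le> d"
    and "\<And>j. j \<in> {1..m2} \<Longrightarrow> convex_poly (h j) \<and> total_deg (h j) \<le> d"
    and "C = sublevel_set m1 g"
    and "D = sublevel_set m2 h"
    and "C \<inter> D \<noteq> {}"
    and "\<eta> > 0"
    and "\<And>t. lam t \<in> {0<..2}"
    and "(INF t. lam t) > 0"
    and "\<And>t. y (Suc t) = damped_proj \<eta> C (x t)"
    and "\<And>t. z (Suc t) = damped_proj \<eta> D (2 *\<^sub>R y (Suc t) - x t)"
    and "\<And>t. x (Suc t) = x t + lam t *\<^sub>R (z (Suc t) - y (Suc t))"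
  shows "\<exists>xbar \<in> C \<inter> D. x \<longlonglongrightarrow> xbar \<and>
    (let \<gamma> = rate_gamma CARD('n) d in
      \<exists>M>0. \<exists>r. 0 < r \<and> r < 1 \<and>
        (\<forall>t\<ge>1. norm (x t - xbar) \<le>
          (if d > 1 then M * real t powr (- (\<gamma> / (2 * (1 - \<gamma>)))) else M * r ^ t)))"
proof -
  note d = assms(1)
  have g: "convex_poly (g i)" "total_deg (g i) \<le> d" if "i \<in> {1..m1}" for i
    using assms(2)[OF that] by auto
  have h: "convex_poly (h j)" "total_deg (h j) \<le> d" if "j \<in> {1..m2}" for j
    using assms(3)[OF that] by auto
  have C: "convex C" "closed C" and D: "convex D" "closed D"
    unfolding assms(4,5) using g h by (auto intro!: convex_sublevel_set closed_sublevel_set)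
  obtain s0 where s0: "s0 \<in> C" "s0 \<in> D" using assms(6) by blast
  define N where "N = d ^ CARD('n)"
  have "N \<ge> 1" using d by (simp add: N_def)
  define e where "e t = max (dist (x t) (closest_point C (x t))) (dist (x t) (closest_point D (x t)))" for t
  define L where "L = (INF t. lam t)"
  have "L > 0" using assms(9) by (simp add: L_def)
  have lam: "L \<le> lam t" "lam t \<le> 2" for t
  proof -
    \<comment> \<open>A real infimum is known to be a lower bound only for sets bounded
      below.\<close>
    have "bdd_below (range lam)"
      using assms(8) by (intro bdd_belowI[of _ 0]) (auto intro: less_imp_le)
    then show "L \<le> lam t" unfolding L_def by (rule cINF_lower) simp
    show "lam t \<le> 2" using assms(8)[of t] by simp
  qed
  define K where "K = L * (4 * \<eta> / (5 * (2 * \<eta> + 1)\<^sup>2))"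
  have "K > 0" unfolding K_def using \<open>L > 0\<close> assms(7) by simp
  have step: "(norm (x (Suc t) - s))\<^sup>2 \<le> (norm (x t - s))\<^sup>2 - K * (e t)\<^sup>2" if "s \<in> C \<inter> D" for s t
  proof -
    have "(norm (x (Suc t) - s))\<^sup>2 \<le> (norm (x t - s))\<^sup>2 - lam t * (4 * \<eta> / (5 * (2 * \<eta> + 1)\<^sup>2)) * (e t)\<^sup>2"
      unfolding e_def using that lam[of t] \<open>L > 0\<close>
      by (intro damped_douglas_rachford_step[OF C D _ _ assms(7) _ _ assms(10) assms(11) assms(12)]) auto
    moreover have "K * (e t)\<^sup>2 \<le> lam t * (4 * \<eta> / (5 * (2 * \<eta> + 1)\<^sup>2)) * (e t)\<^sup>2"
      unfolding K_def using lam[of t] assms(7) by (intro mult_right_mono) auto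
    ultimately show ?thesis by linarith
  qed
  \<comment> \<open>The iterates stay in one ball around \<open>s0\<close>, and since
    \<open>s0\<close> lies in both sets this also bounds \<open>e t\<close>. One constant of the
    local error bound then serves all \<open>t\<close>.\<close>
  have near: "dist (x t) s0 \<le> dist (x 0) s0" for t
  proof (induction t)
    case (Suc t)
    have "0 \<le> K * (e t)\<^sup>2" using \<open>K > 0\<close> by simp
    moreover have "s0 \<in> C \<inter> D" using s0 by simp
    ultimately have "(norm (x (Suc t) - s0))\<^sup>2 \<le> (norm (x t - s0))\<^sup>2" using step[of s0 t] by linarith
    then have "norm (x (Suc t) - s0) \<le> norm (x t - s0)" by (rule power2_le_imp_le) simp
    then show ?case using Suc by (simp add: dist_norm)
  qed simp
  define R where "R = norm s0 + dist (x 0) s0"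
  have xR: "norm (x t) \<le> R" for t
    using near[of t] norm_triangle_ineq2[of "x t" s0] by (simp add: R_def dist_norm)
  have eR: "e t \<le> R" for t
    using closest_point_le[OF C(2) s0(1), of "x t"] closest_point_le[OF D(2) s0(2), of "x t"] near[of t]
      norm_ge_zero[of s0] unfolding e_def R_def by linarith
  \<comment> \<open>The constraints of both sets form one system over a disjoint sum, so its
    solution set is \<open>C \<inter> D\<close>.\<close>
  define f where "f = case_sum (\<lambda>i. poly_fun (g i)) (\<lambda>j. poly_fun (h j))"
  define I where "I = {1..m1} <+> {1..m2}"
  have CD: "(\<forall>i\<in>I. f i s \<le> 0) \<longleftrightarrow> s \<in> C \<inter> D" for s
    by (simp add: I_def Plus_def ball_Un f_def assms(4,5) sublevel_set_def)
  have "finite I" by (simp add: I_def)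
  moreover have "convex_on UNIV (f i)" "line_poly d (f i)" if "i \<in> I" for i
    using that g h by (auto simp: I_def f_def convex_poly_def intro!: line_poly_poly_fun)
  moreover have "f i s0 \<le> 0" if "i \<in> I" for i using that CD[of s0] s0 by blast
  ultimately have "\<exists>c>0. \<forall>x e. norm x \<le> R \<longrightarrow> 0 \<le> e \<longrightarrow> e \<le> R \<longrightarrow>
      (\<forall>i\<in>I. \<exists>p. dist x p \<le> e \<and> f i p \<le> 0) \<longrightarrow>
      (\<exists>s. (\<forall>i\<in>I. f i s \<le> 0) \<and> dist x s ^ (d ^ DIM(real ^ 'n)) \<le> c * e)"
    (is "\<exists>c>0. ?regular c") using d by (intro convex_system_hoelder_regular)
  then obtain c where "c > 0" and "?regular c" by blast
  then have c: "\<And>x e. norm x \<le> R \<Longrightarrow> 0 \<le> e \<Longrightarrow> e \<le> R \<Longrightarrow>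
      \<forall>i\<in>I. \<exists>p. dist x p \<le> e \<and> f i p \<le> 0 \<Longrightarrow> \<exists>s\<in>C \<inter> D. dist x s ^ N \<le> c * e"
    unfolding CD N_def by (simp add: Bex_def)
  \<comment> \<open>The projections on \<open>C\<close> and \<open>D\<close> are the nearby feasible
    points: each satisfies all constraints of its own set.\<close>
  have reg: "\<exists>s\<in>C \<inter> D. dist (x t) s ^ N \<le> c * e t" for t
  proof (rule c[OF xR _ eR])
    show "0 \<le> e t" by (simp add: e_def le_max_iff_disj)
    have "closest_point C (x t) \<in> C" "closest_point D (x t) \<in> D"
      using C D s0 by (auto intro!: closest_point_in_set)
    then have fC: "poly_fun (g i) (closest_point C (x t)) \<le> 0" if "i \<in> {1..m1}" for i
      using that unfolding assms(4) by (simp add: sublevel_set_def)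
    have fD: "poly_fun (h j) (closest_point D (x t)) \<le> 0" if "j \<in> {1..m2}" for j
      using that \<open>closest_point D (x t) \<in> D\<close> unfolding assms(5) by (simp add: sublevel_set_def)
    show "\<forall>i\<in>I. \<exists>p. dist (x t) p \<le> e t \<and> f i p \<le> 0"
    proof
      fix i assume "i \<in> I"
      then consider a where "i = Inl a" "a \<in> {1..m1}" | b where "i = Inr b" "b \<in> {1..m2}"
        unfolding I_def by blast
      then show "\<exists>p. dist (x t) p \<le> e t \<and> f i p \<le> 0"
      proof cases
        case 1
        then show ?thesis using fC by (intro exI[of _ "closest_point C (x t)"]) (simp add: f_def e_def)
      next
        case 2
        then show ?thesis using fD by (intro exI[of _ "closest_point D (x t)"]) (simp add: f_def e_def)
      qed
    qed
  qed
  obtain l where l: "l \<in> C \<inter> D" "x \<longlonglongrightarrow> l"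
    and lin: "N = 1 \<Longrightarrow> \<exists>M>0. \<exists>r. 0 < r \<and> r < 1 \<and> (\<forall>t. norm (x t - l) \<le> M * r ^ t)"
    and sub: "N > 1 \<Longrightarrow> \<exists>M>0. \<forall>t\<ge>1. norm (x t - l) \<le> M * real t powr (- (1 / (2 * (real N - 1))))"
    using fejer_monotone_hoelder_rate[where x=x and e=e, OF closed_Int[OF C(2) D(2)] assms(6) \<open>K > 0\<close> \<open>c > 0\<close> \<open>N \<ge> 1\<close> step reg]
    by blast
  have "\<exists>M>0. \<exists>r. 0 < r \<and> r < 1 \<and> (\<forall>t\<ge>1. norm (x t - l) \<le>
      (if d > 1 then M * real t powr (- (rate_gamma CARD('n) d / (2 * (1 - rate_gamma CARD('n) d)))) else M * r ^ t))"
  proof (cases "d > 1")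
    case False
    then have "d = 1" using d by simp
    then have "N = 1" by (simp add: N_def)
    then show ?thesis using lin False by auto
  next
    case True
    then have "N > 1" unfolding N_def by (intro one_less_power) auto
    \<comment> \<open>With G = 1 / \<gamma> the exponent \<gamma> / (2 (1 - \<gamma>)) is 1 / (2 (G
      - 1)). As N \<le> G, the rate obtained for \<open>N\<close> is at least as fast for t \<ge>
      1.\<close>
    define G where "G = inverse (rate_gamma CARD('n) d)"
    have "real N \<le> G"
      using degree_power_le_inverse_rate_gamma[OF d, of "CARD('n)"] by (simp add: G_def N_def)
    have "G > 1" using \<open>real N \<le> G\<close> \<open>N > 1\<close> by linarith
    have "rate_gamma CARD('n) d = 1 / G" by (simp add: G_def inverse_eq_divide)
    moreover have "(1 / G) / (2 * (1 - 1 / G)) = 1 / (2 * (G - 1))"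
      using \<open>G > 1\<close> by (simp add: field_simps)
    ultimately have \<gamma>: "rate_gamma CARD('n) d / (2 * (1 - rate_gamma CARD('n) d)) = 1 / (2 * (G - 1))"
      by simp
    obtain M where "M > 0" and M: "\<And>t. t \<ge> 1 \<Longrightarrow> norm (x t - l) \<le> M * real t powr (- (1 / (2 * (real N - 1))))"
      using sub[OF \<open>N > 1\<close>] by blast
    have "norm (x t - l) \<le> M * real t powr (- (1 / (2 * (G - 1))))" if "t \<ge> 1" for t
    proof -
      have "1 / (2 * (G - 1)) \<le> 1 / (2 * (real N - 1))"
        using \<open>real N \<le> G\<close> \<open>N > 1\<close> by (intro divide_left_mono) auto
      then have "real t powr (- (1 / (2 * (real N - 1)))) \<le> real t powr (- (1 / (2 * (G - 1))))"
        using that by (intro powr_mono) auto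
      then have "M * real t powr (- (1 / (2 * (real N - 1)))) \<le> M * real t powr (- (1 / (2 * (G - 1))))"
        using \<open>M > 0\<close> by (intro mult_left_mono) auto
      then show ?thesis using M[OF that] by linarith
    qed
    \<comment> \<open>\<open>1/2\<close> is a placeholder for \<open>r\<close>, which enters only
      the bound for d = 1.\<close>
    then have "0 < (1/2 :: real) \<and> (1/2 :: real) < 1 \<and> (\<forall>t\<ge>1. norm (x t - l) \<le>
        (if d > 1 then M * real t powr (- (1 / (2 * (G - 1)))) else M * (1/2) ^ t))"
      using True by simp
    then show ?thesis
      unfolding \<gamma> using \<open>M > 0\<close> by blast
  qed
  then show ?thesis unfolding Let_def using l by blast
qed

end
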